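(* Consider the single-input single-output linear control system $$z(t+1)=Az(t)+Bu(t),\qquad \theta(t)=Cz(t)+\omega(t),$$ with $z(t)\in\mathbb{R}^N$, $u(t),\theta(t)\in\mathbb{R}$, where $\omega(t)$ is zero-mean i.i.d. Gaussian output noise with covariance $\Sigma_\omega$, and $u(t)$ is an i.i.d. Gaussian sequence with $\mathrm{E}[u(t)u(t+k)^\top]=0$ for all $k\neq0$ and $\mathrm{E}[z(t)u(t)^\top]=0$, and $z(t)$ is Gaussian. Let $\Sigma_z$ and $\Sigma_u$ be the covariances of $z(t)$ and $u(t)$. Then the information transfer from the input $u$ to the output $\theta$ from time $t$ to $t+1$ is $$T_{u\to\theta}=\frac12\log\frac{|\Sigma_{\theta'|\theta}|}{|\Sigma_{\theta'_{\not u}|\theta_{\not u}}|},$$ where $|\cdot|$ is the determinant, $$\Sigma_{\theta'|\theta}=CA\Sigma_zA^\top C^\top+CB\Sigma_uB^\top C^\top+\Sigma_\omega-(CA\Sigma_zC^\top)(C\Sigma_zC^\top)^{-1}(CA\Sigma_zC^\top)^\top$$ and $$\Sigma_{\theta'_{\not u}|\theta_{\not u}}=CA\Sigma_zA^\top C^\top+\Sigma_\omega-(CA\Sigma_zC^\top)(C\Sigma_zC^\top)^{-1}(CA\Sigma_zC^\top)^\top.$$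
   Context: The (one-step) information transfer from the input $u$ to the output $\theta$ is $$T_{u\to\theta}=H(\theta(t+1)\mid\theta(t))-H_{\not u}(\theta(t+1)\mid\theta(t)),$$ where $H(\cdot\mid\cdot)$ is conditional differential entropy and $H_{\not u}$ is the same conditional entropy when $u$ is frozen (held at a constant deterministic value), so that, up to a constant shift, the system is $z(t+1)=Az(t)$, $\theta(t)=Cz(t)+\omega(t)$, with $z(t)$ having the same distribution as in the original system. The notation $\theta'$ means $\theta(t+1)$, $\theta$ means $\theta(t)$; $\Sigma_{\theta'|\theta}$ and $\Sigma_{\theta'_{\not u}|\theta_{\not u}}$ are the conditional covariances of $\theta(t+1)$ given $\theta(t)$ in the original system and in the system with $u$ frozen.
   Formalization: The inverse (CΣ_zC^T)^{-1} is corrected to (CΣ_zC^T+Σ_ω)^{-1}, since θ(t) contains ω(t); (z(t),u(t)) is taken jointly Gaussian, ω independent of (z,u), and the inverse and logarithm are assumed well defined. *)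

theory Defs
  imports "HOL-Probability.Probability"
begin

text \<open>
  Gaussian random vectors, the singular case included: every linear functional of the vector is
  normal or almost surely constant.  For a pair this is joint Gaussianity.  The parameter
  \<open>s\<close> is a standard deviation.
\<close>

definition gaussian_law :: "real \<Rightarrow> real \<Rightarrow> real measure" where
  "gaussian_law m s =
     (if s = 0 then return borel m else density lborel (\<lambda>x. ennreal (normal_density m s x)))"

definition gaussian_rv :: "'a measure \<Rightarrow> ('a \<Rightarrow> 'v::euclidean_space) \<Rightarrow> bool" where
  "gaussian_rv M X \<longleftrightarrow>
     X \<in> borel_measurable M \<and>
     (\<forall>v. \<exists>m s. 0 \<le> s \<and> distr M borel (\<lambda>x. v \<bullet> X x) = gaussian_law m s)"

definition cov_matrix :: "'a measure \<Rightarrow> ('a \<Rightarrow> real ^ 'n) \<Rightarrow> real ^ 'n ^ 'n" where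
  "cov_matrix M X =
     (\<chi> i j. \<integral>x. (X x $ i - (\<integral>y. X y $ i \<partial>M)) * (X x $ j - (\<integral>y. X y $ j \<partial>M)) \<partial>M)"

text \<open>
  Independence of two random elements with values in possibly different types, which the
  library's \<open>indep_var\<close> does not cover.
\<close>

definition indep_rv ::
    "'a measure \<Rightarrow> 'b measure \<Rightarrow> ('a \<Rightarrow> 'b) \<Rightarrow> 'c measure \<Rightarrow> ('a \<Rightarrow> 'c) \<Rightarrow> bool" where
  "indep_rv M N X N' Y \<longleftrightarrow>
     prob_space.indep_set M (sets (vimage_algebra (space M) X N))
                            (sets (vimage_algebra (space M) Y N'))"

text \<open>
  The conditional covariance of \<open>X\<close> given \<open>Y\<close> is a random variable in general.
  For Gaussian pairs it is almost surely constant.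
\<close>

definition cond_cov ::
    "'a measure \<Rightarrow> ('a \<Rightarrow> real) \<Rightarrow> ('a \<Rightarrow> real) \<Rightarrow> 'a \<Rightarrow> real" where
  "cond_cov M X Y =
     (let F = vimage_algebra (space M) Y borel
      in real_cond_exp M F (\<lambda>x. (X x - real_cond_exp M F X x)\<^sup>2))"

text \<open>Conditional differential entropy, with logarithms to base \<open>b\<close>.\<close>

abbreviation diff_cond_entropy ::
    "real \<Rightarrow> 'a measure \<Rightarrow> ('a \<Rightarrow> real) \<Rightarrow> ('a \<Rightarrow> real) \<Rightarrow> real" where
  "diff_cond_entropy b M X Y \<equiv> prob_space.conditional_entropy M b lborel lborel X Y"

text \<open>
  The output at time \<open>t + 1\<close> when the input is frozen at the value \<open>c\<close>.  The frozen system
  starts from the same state \<open>z t\<close>, so its output at time \<open>t\<close> is the original one.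
\<close>

definition frozen_output ::
    "real ^ 'n ^ 'n \<Rightarrow> real ^ 1 ^ 'n \<Rightarrow> real ^ 'n ^ 1 \<Rightarrow> (nat \<Rightarrow> 'a \<Rightarrow> real ^ 'n) \<Rightarrow>
     (nat \<Rightarrow> 'a \<Rightarrow> real) \<Rightarrow> real \<Rightarrow> nat \<Rightarrow> 'a \<Rightarrow> real" where
  "frozen_output A B C z \<omega> c t = (\<lambda>x. (C *v (A *v z t x + B *v vec c)) $ 1 + \<omega> (Suc t) x)"

definition information_transfer ::
    "real \<Rightarrow> 'a measure \<Rightarrow> real ^ 'n ^ 'n \<Rightarrow> real ^ 1 ^ 'n \<Rightarrow> real ^ 'n ^ 1 \<Rightarrow>
     (nat \<Rightarrow> 'a \<Rightarrow> real ^ 'n) \<Rightarrow> (nat \<Rightarrow> 'a \<Rightarrow> real) \<Rightarrow> (nat \<Rightarrow> 'a \<Rightarrow> real) \<Rightarrow> real \<Rightarrow> nat \<Rightarrow> real" where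
  "information_transfer b M A B C z \<omega> \<theta> c t =
     diff_cond_entropy b M (\<theta> (Suc t)) (\<theta> t) -
     diff_cond_entropy b M (frozen_output A B C z \<omega> c t) (\<theta> t)"

text \<open>
  Closed forms for the conditional covariance of the output at time \<open>t + 1\<close>.  The argument
  \<open>V\<close> is the covariance of the variable conditioned on: \<open>C \<Sigma>\<^sub>z C\<^sup>T + \<Sigma>\<^sub>\<omega>\<close> for the
  output \<open>\<theta> t\<close>, and \<open>C \<Sigma>\<^sub>z C\<^sup>T\<close> for its noise-free part \<open>C z(t)\<close>.  Both have the
  same covariance \<open>C A \<Sigma>\<^sub>z C\<^sup>T\<close> with \<open>\<theta> (t + 1)\<close>.
\<close>

definition Sigma_cond ::
    "real ^ 'n ^ 'n \<Rightarrow> real ^ 1 ^ 'n \<Rightarrow> real ^ 'n ^ 1 \<Rightarrow>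
     real ^ 'n ^ 'n \<Rightarrow> real ^ 1 ^ 1 \<Rightarrow> real ^ 1 ^ 1 \<Rightarrow> real ^ 1 ^ 1 \<Rightarrow> real ^ 1 ^ 1" where
  "Sigma_cond A B C Sz Su Sw V =
     C ** A ** Sz ** transpose A ** transpose C + C ** B ** Su ** transpose B ** transpose C + Sw
     - (C ** A ** Sz ** transpose C) ** matrix_inv V ** transpose (C ** A ** Sz ** transpose C)"

definition Sigma_cond_frozen ::
    "real ^ 'n ^ 'n \<Rightarrow> real ^ 'n ^ 1 \<Rightarrow>
     real ^ 'n ^ 'n \<Rightarrow> real ^ 1 ^ 1 \<Rightarrow> real ^ 1 ^ 1 \<Rightarrow> real ^ 1 ^ 1" where
  "Sigma_cond_frozen A C Sz Sw V =
     C ** A ** Sz ** transpose A ** transpose C + Sw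
     - (C ** A ** Sz ** transpose C) ** matrix_inv V ** transpose (C ** A ** Sz ** transpose C)"

end

theory Submission
  imports Defs
begin

text \<open>
  For a jointly Gaussian pair \<open>(X, Y)\<close> with \<open>Var Y > 0\<close>, the residual
  \<open>R = X - k Y\<close> with \<open>k = Cov(X, Y) / Var Y\<close> is Gaussian and uncorrelated with \<open>Y\<close>, hence
  independent of it.  So \<open>Cov(X | Y)\<close> is the constant \<open>Var R = Var X - Cov(X, Y)\<^sup>2 / Var Y\<close>, and
  \<open>H(X | Y) = H(R) = log (2 \<pi> e Var R) / 2\<close>.  Freezing the input removes from \<open>Var X\<close> exactly the
  term \<open>C B \<Sigma>\<^sub>u B\<^sup>T C\<^sup>T\<close>, and the factors \<open>2 \<pi> e\<close> cancel in the difference of the entropies.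

  That an uncorrelated Gaussian pair is independent follows from Levy's uniqueness theorem on the
  real line alone.  Suppose the characteristic function of \<open>(X, Y)\<close> factorizes.  Under the
  measures with densities proportional to \<open>1 + cos (t Y)\<close> and \<open>1 + sin (t Y)\<close>, the variable \<open>X\<close>
  keeps its characteristic function and hence its law; so \<open>E[exp (i t Y); X \<in> A]\<close> factorizes for
  every \<open>t\<close>, and the same argument with the density \<open>1\<^sub>A(X)\<close> gives the law of \<open>Y\<close> given \<open>X \<in> A\<close>.
\<close>

subsection \<open>Gaussian laws and Gaussian random vectors\<close>

text \<open>As an affine image of the standard normal law, the point mass \<open>s = 0\<close> is
  covered together with the densities. Characteristic function and moments then follow without a
  case split.\<close>

lemma gaussian_law_eq_distr_std_normal:
  assumes "0 \<le> s"
  shows "gaussian_law m s = distr std_normal_distribution borel (\<lambda>x. m + s * x)"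
proof -
  interpret S: prob_space std_normal_distribution
    by (rule prob_space_normal_density) simp
  show ?thesis
  proof (cases "s = 0")
    case True
    then show ?thesis by (simp add: gaussian_law_def S.distr_const)
  next
    case False
    with assms have "0 < s" by simp
    have "distributed std_normal_distribution lborel (\<lambda>x. x) std_normal_density"
      unfolding distributed_def by (auto simp: distr_id2)
    from S.normal_density_affine[OF this, of s m] \<open>0 < s\<close>
    have "distributed std_normal_distribution lborel (\<lambda>x. m + s * x) (normal_density m s)"
      by simp
    then have "distr std_normal_distribution lborel (\<lambda>x. m + s * x)
        = density lborel (\<lambda>x. ennreal (normal_density m s x))"
      by (rule distributed_distr_eq_density)
    moreover have "distr std_normal_distribution lborel (\<lambda>x. m + s * x)
        = distr std_normal_distribution borel (\<lambda>x. m + s * x)"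
      by (intro distr_cong) auto
    ultimately show ?thesis using False by (simp add: gaussian_law_def)
  qed
qed

lemma real_distribution_gaussian_law:
  assumes "0 \<le> s"
  shows "real_distribution (gaussian_law m s)"
proof -
  interpret S: prob_space std_normal_distribution
    by (rule prob_space_normal_density) simp
  show ?thesis
    unfolding gaussian_law_eq_distr_std_normal[OF assms]
    by (intro S.real_distribution_distr) simp
qed

lemma char_gaussian_law:
  assumes "0 \<le> s"
  shows "char (gaussian_law m s) t = iexp (t * m) * exp (- (s * t)\<^sup>2 / 2)"
proof -
  have "char (gaussian_law m s) t = (CLINT x|std_normal_distribution. iexp (t * (m + s * x)))"
    unfolding gaussian_law_eq_distr_std_normal[OF assms] char_def
    by (simp add: integral_distr)
  also have "\<dots> = (CLINT x|std_normal_distribution. iexp (t * m) * iexp ((s * t) * x))"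
    by (intro Bochner_Integration.integral_cong) (auto simp: exp_add[symmetric] algebra_simps)
  also have "\<dots> = iexp (t * m) * char std_normal_distribution (s * t)"
    unfolding char_def by simp
  finally show ?thesis by (simp add: char_std_normal_distribution)
qed

lemma gaussian_law_moments:
  assumes "0 \<le> s"
  shows "integrable (gaussian_law m s) (\<lambda>x. x)"
    and "integrable (gaussian_law m s) (\<lambda>x. x\<^sup>2)"
    and "(\<integral>x. x \<partial>gaussian_law m s) = m"
    and "(\<integral>x. (x - m)\<^sup>2 \<partial>gaussian_law m s) = s\<^sup>2"
proof -
  let ?S = std_normal_distribution
  interpret S: prob_space ?S
    by (rule prob_space_normal_density) simp
  have [simp]: "integrable ?S (\<lambda>x. x)" "integrable ?S (\<lambda>x. x\<^sup>2)"
    using integrable_std_normal_distribution_moment[of 1]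
      integrable_std_normal_distribution_moment[of 2] by simp_all
  have [simp]: "(\<integral>x. x \<partial>?S) = 0" "(\<integral>x. x\<^sup>2 \<partial>?S) = 1"
    using integral_std_normal_distribution_moment_odd[of 1]
      std_normal_distribution_even_moments(1)[of 1] by (simp_all add: fact_numeral)
  have [simp]: "S.prob UNIV = 1"
    using S.prob_space by (simp only: space_density space_lborel space_borel)
  have sq: "(m + s * x)\<^sup>2 = m\<^sup>2 + (2 * m * s * x + s\<^sup>2 * x\<^sup>2)" for x
    by (simp add: power2_eq_square algebra_simps)
  show "integrable (gaussian_law m s) (\<lambda>x. x)" "(\<integral>x. x \<partial>gaussian_law m s) = m"
    unfolding gaussian_law_eq_distr_std_normal[OF assms]
    by (simp_all add: integrable_distr_eq integral_distr)
  show "integrable (gaussian_law m s) (\<lambda>x. x\<^sup>2)"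
    unfolding gaussian_law_eq_distr_std_normal[OF assms]
    by (simp add: integrable_distr_eq sq)
  show "(\<integral>x. (x - m)\<^sup>2 \<partial>gaussian_law m s) = s\<^sup>2"
    unfolding gaussian_law_eq_distr_std_normal[OF assms]
    by (simp add: integral_distr power_mult_distrib)
qed

context prob_space
begin

text \<open>Taking \<open>v = 1\<close> in the definition gives the law of \<open>X\<close> itself;
  its location and squared scale are then recognised as mean and variance.\<close>

lemma gaussian_rv_realE:
  fixes X :: "'a \<Rightarrow> real"
  assumes "gaussian_rv M X"
  obtains s where "0 \<le> s" "distr M borel X = gaussian_law (expectation X) s" "variance X = s\<^sup>2"
    "integrable M X" "integrable M (\<lambda>x. (X x)\<^sup>2)"
proof -
  from assms have [measurable]: "X \<in> borel_measurable M" by (simp add: gaussian_rv_def)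
  from assms obtain m s where s: "0 \<le> s" and d: "distr M borel (\<lambda>x. 1 \<bullet> X x) = gaussian_law m s"
    unfolding gaussian_rv_def by blast
  from d have d: "distr M borel X = gaussian_law m s" by simp
  note mom = gaussian_law_moments[OF s, of m, folded d]
  have m: "expectation X = m" using mom(3) by (simp add: integral_distr)
  show thesis
  proof (rule that[OF s])
    show "distr M borel X = gaussian_law (expectation X) s" by (simp add: d m)
    show "variance X = s\<^sup>2" using mom(4) by (simp add: integral_distr m)
    show "integrable M X" "integrable M (\<lambda>x. (X x)\<^sup>2)"
      using mom(1,2) by (simp_all add: integrable_distr_eq)
  qed
qed

text \<open>The frequency is fixed at 1: other frequencies are obtained by applying this to scaled
  variables and linear combinations, which are again Gaussian.\<close>

lemma gaussian_rv_iexp: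
  fixes X :: "'a \<Rightarrow> real"
  assumes "gaussian_rv M X"
  shows "(CLINT x|M. iexp (X x)) = iexp (expectation X) * exp (- variance X / 2)"
proof -
  from assms have [measurable]: "X \<in> borel_measurable M" by (simp add: gaussian_rv_def)
  from gaussian_rv_realE[OF assms] obtain s where s: "0 \<le> s"
    "distr M borel X = gaussian_law (expectation X) s" "variance X = s\<^sup>2" by blast
  have "(CLINT x|M. iexp (X x)) = char (distr M borel X) 1"
    by (simp add: char_def integral_distr)
  then show ?thesis using char_gaussian_law[OF s(1), of "expectation X" 1] s(2,3) by simp
qed

text \<open>By Levy's uniqueness theorem the characteristic function determines the law, so closure
  properties of Gaussian vectors reduce to integrals of exponentials.\<close>

lemma gaussian_rvI_iexp:
  fixes X :: "'a \<Rightarrow> 'v::euclidean_space"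
  assumes X[measurable]: "X \<in> borel_measurable M"
    and "\<And>v. \<exists>m s. 0 \<le> s \<and>
      (\<forall>t. (CLINT x|M. iexp (t * (v \<bullet> X x))) = iexp (t * m) * exp (- (s * t)\<^sup>2 / 2))"
  shows "gaussian_rv M X"
  unfolding gaussian_rv_def
proof (intro conjI allI X)
  fix v :: 'v
  from assms(2) obtain m s where s: "0 \<le> s"
    and ch: "\<And>t. (CLINT x|M. iexp (t * (v \<bullet> X x))) = iexp (t * m) * exp (- (s * t)\<^sup>2 / 2)" by metis
  have "distr M borel (\<lambda>x. v \<bullet> X x) = gaussian_law m s"
  proof (rule Levy_uniqueness)
    show "real_distribution (distr M borel (\<lambda>x. v \<bullet> X x))"
      by (rule real_distribution_distr) simp
    show "char (distr M borel (\<lambda>x. v \<bullet> X x)) = char (gaussian_law m s)"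
      unfolding char_gaussian_law[OF s] fun_eq_iff
      using ch by (simp add: char_def integral_distr)
  qed (rule real_distribution_gaussian_law[OF s])
  with s show "\<exists>m s. 0 \<le> s \<and> distr M borel (\<lambda>x. v \<bullet> X x) = gaussian_law m s" by blast
qed

lemma gaussian_rv_linear_functional_iexp:
  fixes X :: "'a \<Rightarrow> 'v::euclidean_space"
  assumes "gaussian_rv M X"
  shows "\<exists>m s. 0 \<le> s \<and>
      (\<forall>t. (CLINT x|M. iexp (t * (v \<bullet> X x))) = iexp (t * m) * exp (- (s * t)\<^sup>2 / 2))"
proof -
  from assms have [measurable]: "X \<in> borel_measurable M" by (simp add: gaussian_rv_def)
  from assms obtain m s where s: "0 \<le> s" and d: "distr M borel (\<lambda>x. v \<bullet> X x) = gaussian_law m s"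
    unfolding gaussian_rv_def by blast
  have "(CLINT x|M. iexp (t * (v \<bullet> X x))) = char (distr M borel (\<lambda>x. v \<bullet> X x)) t" for t
    by (simp add: char_def integral_distr)
  then show ?thesis using s char_gaussian_law[OF s] by (auto simp: d)
qed

text \<open>The functional \<open>v\<close> of \<open>f (X x)\<close> is the functional
  \<open>adjoint f v\<close> of \<open>X x\<close>.\<close>

lemma gaussian_rv_linear:
  fixes X :: "'a \<Rightarrow> 'v::euclidean_space" and f :: "'v \<Rightarrow> 'w::euclidean_space"
  assumes X: "gaussian_rv M X" and f: "linear f"
  shows "gaussian_rv M (\<lambda>x. f (X x))"
proof -
  have "f \<in> borel_measurable borel"
    using f by (intro borel_measurable_continuous_onI linear_continuous_on) (simp add: linear_conv_bounded_linear)
  moreover have "v \<bullet> f y = adjoint f v \<bullet> y" for v y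
    using adjoint_works[OF f, of y v] by (simp add: inner_commute)
  ultimately show ?thesis using X by (auto simp: gaussian_rv_def)
qed

text \<open>Translation multiplies the characteristic function by a phase, which moves the mean by
  \<open>v \<bullet> k\<close> and keeps the scale.\<close>

lemma gaussian_rv_translate:
  fixes X :: "'a \<Rightarrow> 'v::euclidean_space"
  assumes X: "gaussian_rv M X"
  shows "gaussian_rv M (\<lambda>x. X x + k)"
proof (rule gaussian_rvI_iexp)
  from X have [measurable]: "X \<in> borel_measurable M" by (simp add: gaussian_rv_def)
  then show "(\<lambda>x. X x + k) \<in> borel_measurable M" by simp
  fix v
  from gaussian_rv_linear_functional_iexp[OF X, of v] obtain m s where s: "0 \<le> s" and
    ch: "\<And>t. (CLINT x|M. iexp (t * (v \<bullet> X x))) = iexp (t * m) * exp (- (s * t)\<^sup>2 / 2)" by metis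
  have "(CLINT x|M. iexp (t * (v \<bullet> (X x + k)))) = iexp (t * (m + v \<bullet> k)) * exp (- (s * t)\<^sup>2 / 2)" for t
  proof -
    have "(CLINT x|M. iexp (t * (v \<bullet> (X x + k)))) = (CLINT x|M. iexp (t * (v \<bullet> k)) * iexp (t * (v \<bullet> X x)))"
      by (intro Bochner_Integration.integral_cong) (auto simp: exp_add[symmetric] inner_add_right algebra_simps)
    also have "\<dots> = iexp (t * (v \<bullet> k)) * (iexp (t * m) * exp (- (s * t)\<^sup>2 / 2))"
      by (simp add: ch del: of_real_mult)
    finally show ?thesis by (simp add: exp_add distrib_left)
  qed
  with s show "\<exists>m s. 0 \<le> s \<and> (\<forall>t. (CLINT x|M. iexp (t * (v \<bullet> (X x + k))))
      = iexp (t * m) * exp (- (s * t)\<^sup>2 / 2))" by blast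
qed

text \<open>For independent summands characteristic functions multiply: means add, and since scales
  are standard deviations they combine as the root of the sum of squares.\<close>

lemma gaussian_rv_add_indep:
  fixes X Y :: "'a \<Rightarrow> 'v::euclidean_space"
  assumes X: "gaussian_rv M X" and Y: "gaussian_rv M Y" and ind: "indep_var borel X borel Y"
  shows "gaussian_rv M (\<lambda>x. X x + Y x)"
proof (rule gaussian_rvI_iexp)
  from X Y have [measurable]: "X \<in> borel_measurable M" "Y \<in> borel_measurable M"
    by (simp_all add: gaussian_rv_def)
  then show "(\<lambda>x. X x + Y x) \<in> borel_measurable M" by simp
  fix v
  from gaussian_rv_linear_functional_iexp[OF X, of v] obtain m s where s: "0 \<le> s" and
    ch: "\<And>t. (CLINT x|M. iexp (t * (v \<bullet> X x))) = iexp (t * m) * exp (- (s * t)\<^sup>2 / 2)" by metis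
  from gaussian_rv_linear_functional_iexp[OF Y, of v] obtain m' s' where s': "0 \<le> s'" and
    ch': "\<And>t. (CLINT x|M. iexp (t * (v \<bullet> Y x))) = iexp (t * m') * exp (- (s' * t)\<^sup>2 / 2)" by metis
  have ind': "indep_var borel (\<lambda>x. v \<bullet> X x) borel (\<lambda>x. v \<bullet> Y x)"
    using indep_var_compose[OF ind, of "\<lambda>x. v \<bullet> x" borel "\<lambda>x. v \<bullet> x" borel] by (simp add: comp_def)
  have "(CLINT x|M. iexp (t * (v \<bullet> (X x + Y x))))
      = iexp (t * (m + m')) * exp (- (sqrt (s\<^sup>2 + s'\<^sup>2) * t)\<^sup>2 / 2)" for t
  proof -
    have "(CLINT x|M. iexp (t * (v \<bullet> (X x + Y x))))
        = char (distr M borel (\<lambda>x. v \<bullet> X x + v \<bullet> Y x)) t"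
      by (simp add: char_def integral_distr inner_add_right)
    also have "\<dots> = (CLINT x|M. iexp (t * (v \<bullet> X x))) * (CLINT x|M. iexp (t * (v \<bullet> Y x)))"
      unfolding char_distr_add[OF ind'] by (simp add: char_def integral_distr)
    also have "\<dots> = iexp (t * (m + m')) * complex_of_real (exp (- (s * t)\<^sup>2 / 2) * exp (- (s' * t)\<^sup>2 / 2))"
      unfolding ch ch' by (simp add: exp_add distrib_left)
    also have "exp (- (s * t)\<^sup>2 / 2) * exp (- (s' * t)\<^sup>2 / 2) = exp (- (sqrt (s\<^sup>2 + s'\<^sup>2) * t)\<^sup>2 / 2)"
      by (simp add: exp_add[symmetric] power_mult_distrib field_simps)
    finally show ?thesis .
  qed
  moreover have "0 \<le> sqrt (s\<^sup>2 + s'\<^sup>2)" by simp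
  ultimately show "\<exists>m s. 0 \<le> s \<and> (\<forall>t. (CLINT x|M. iexp (t * (v \<bullet> (X x + Y x))))
      = iexp (t * m) * exp (- (s * t)\<^sup>2 / 2))" by blast
qed

end

subsection \<open>Independence from characteristic functions\<close>

context prob_space
begin

text \<open>Levy uniqueness, applied to the law of \<open>X\<close> under the probability measure with density proportional to \<open>w\<close>.\<close>

lemma weight_uncorrelated_events:
  fixes w X :: "'a \<Rightarrow> real"
  assumes w[measurable]: "integrable M w" and w0: "\<And>x. 0 \<le> w x"
    and X[measurable]: "X \<in> borel_measurable M"
    and eq: "\<And>s. (CLINT x|M. w x * iexp (s * X x)) = expectation w * (CLINT x|M. iexp (s * X x))"
    and A[measurable]: "A \<in> sets borel"
  shows "expectation (\<lambda>x. w x * indicator A (X x)) = expectation w * expectation (\<lambda>x. indicator A (X x))"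
\<comment> \<open>A weight of total mass zero cannot be normalised to a probability density. It
  vanishes almost everywhere, and both sides are zero.\<close>
proof (cases "expectation w = 0")
  case True
  with w w0 have "AE x in M. w x = 0"
    using integral_nonneg_eq_0_iff_AE by blast
  then have "expectation (\<lambda>x. w x * indicator A (X x)) = expectation (\<lambda>x. 0)"
    by (intro integral_cong_AE) auto
  with True show ?thesis by simp
next
  case False
  define k where "k = expectation w"
  have k: "0 < k" using False w0 by (simp add: k_def order.not_eq_order_implies_strict)
  define N where "N = density M (\<lambda>x. ennreal (w x / k))"
  have [measurable]: "w \<in> borel_measurable M" using w by blast
  have sets_N[measurable_cong, simp]: "sets N = sets M" by (simp add: N_def)
  have space_N: "space N = space M" by (simp add: N_def)
  have int_N: "(\<integral>x. f x \<partial>N) = (\<integral>x. (w x / k) *\<^sub>R f x \<partial>M)"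
    if "f \<in> borel_measurable M" for f :: "'a \<Rightarrow> 'b::{banach, second_countable_topology}"
    unfolding N_def using that k w0 by (intro integral_density) auto
  have "emeasure N (space N) = (\<integral>\<^sup>+x. ennreal (w x / k) \<partial>M)"
    unfolding space_N by (simp add: N_def emeasure_density cong: nn_integral_cong)
  also have "\<dots> = ennreal (\<integral>x. w x / k \<partial>M)"
    using k w w0 by (intro nn_integral_eq_integral) auto
  also have "\<dots> = 1" using k by (simp add: k_def)
  finally interpret N: prob_space N by (rule prob_spaceI)
  have X_N[measurable]: "X \<in> borel_measurable N" by simp
  have "distr N borel X = distr M borel X"
  proof (rule Levy_uniqueness)
    show "char (distr N borel X) = char (distr M borel X)"
    proof
      fix s
      have "char (distr N borel X) s = (CLINT x|M. (w x * iexp (s * X x)) / k)"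
        by (simp add: char_def integral_distr int_N scaleR_conv_of_real)
      also have "\<dots> = char (distr M borel X) s"
        using k by (simp add: eq k_def[symmetric] char_def integral_distr del: of_real_mult)
      finally show "char (distr N borel X) s = char (distr M borel X) s" .
    qed
  qed (simp_all add: N.real_distribution_distr real_distribution_distr)
  then have "(\<integral>x. indicator A (X x) \<partial>N) = (\<integral>x. indicator A (X x) \<partial>M :: real)"
    using integral_distr[OF X_N, of "indicator A :: real \<Rightarrow> real"]
      integral_distr[OF X, of "indicator A :: real \<Rightarrow> real"] by simp
  then have "(\<integral>x. w x * indicator A (X x) / k \<partial>M) = expectation (\<lambda>x. indicator A (X x))"
    using int_N[of "\<lambda>x. indicator A (X x) :: real"] by simp
  with k show ?thesis by (simp add: k_def field_simps)
qed

lemma iexp_integrable: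
  fixes X :: "'a \<Rightarrow> real"
  assumes "X \<in> borel_measurable M"
  shows "integrable M (\<lambda>x. iexp (X x))"
  using assms by (intro integrable_iexp) auto

theorem indep_var_if_iexp_factorizes:
  fixes X Y :: "'a \<Rightarrow> real"
  assumes X[measurable]: "X \<in> borel_measurable M" and Y[measurable]: "Y \<in> borel_measurable M"
    and fac: "\<And>s t. (CLINT x|M. iexp (s * X x + t * Y x))
      = (CLINT x|M. iexp (s * X x)) * (CLINT x|M. iexp (t * Y x))"
  shows "indep_var borel X borel Y"
proof -
  have fac': "(CLINT x|M. iexp (t * Y x) * iexp (s * X x))
      = (CLINT x|M. iexp (t * Y x)) * (CLINT x|M. iexp (s * X x))" for s t
    using fac[of s t] by (simp add: exp_add[symmetric] algebra_simps)
  have int1: "integrable M (\<lambda>x. iexp (t * Y x))" for t by (rule iexp_integrable) simp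
  have int2: "integrable M (\<lambda>x. iexp (t * Y x) * iexp (s * X x))" for s t
    using iexp_integrable[of "\<lambda>x. t * Y x + s * X x"] by (simp add: exp_add distrib_left)
  have intc: "integrable M (\<lambda>x. cos (t * Y x))" "integrable M (\<lambda>x. sin (t * Y x))" for t
    by (auto intro!: integrable_const_bound[where B=1])
  \<comment> \<open>Writing cosine and sine through the exponentials at \<open>t\<close> and
    \<open>- t\<close> transfers the factorization \<open>fac'\<close> to trigonometric
    weights.\<close>
  have cos_eq: "complex_of_real (cos y) = (iexp y + iexp (- y)) / 2"
    and sin_eq: "complex_of_real (sin y) = (iexp y - iexp (- y)) / (2 * \<i>)" for y
    by (simp_all add: cos_of_real sin_of_real cos_exp_eq sin_exp_eq flip: cos_of_real sin_of_real)
  have cos_fac: "(CLINT x|M. cos (t * Y x) * iexp (s * X x))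
        = expectation (\<lambda>x. cos (t * Y x)) * (CLINT x|M. iexp (s * X x))" for s t
  proof -
    have "complex_of_real (expectation (\<lambda>x. cos (t * Y x)))
        = (CLINT x|M. (iexp (t * Y x) + iexp (- t * Y x)) / 2)"
      by (simp add: cos_eq flip: integral_complex_of_real)
    also have "\<dots> = ((CLINT x|M. iexp (t * Y x)) + (CLINT x|M. iexp (- t * Y x))) / 2"
      using int1[of t] int1[of "- t"] by (simp del: of_real_mult of_real_minus mult_minus_left)
    finally have *: "complex_of_real (expectation (\<lambda>x. cos (t * Y x)))
        = ((CLINT x|M. iexp (t * Y x)) + (CLINT x|M. iexp (- t * Y x))) / 2" .
    have "(CLINT x|M. cos (t * Y x) * iexp (s * X x))
        = (CLINT x|M. (iexp (t * Y x) * iexp (s * X x) + iexp (- t * Y x) * iexp (s * X x)) / 2)"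
      by (simp add: cos_eq distrib_right)
    also have "\<dots> = ((CLINT x|M. iexp (t * Y x) * iexp (s * X x))
        + (CLINT x|M. iexp (- t * Y x) * iexp (s * X x))) / 2"
      using int2[of t s] int2[of "- t" s] by (simp del: of_real_mult of_real_minus mult_minus_left)
    finally show ?thesis unfolding fac' * by (simp only: distrib_right times_divide_eq_left)
  qed
  have sin_fac: "(CLINT x|M. sin (t * Y x) * iexp (s * X x))
        = expectation (\<lambda>x. sin (t * Y x)) * (CLINT x|M. iexp (s * X x))" for s t
  proof -
    have "complex_of_real (expectation (\<lambda>x. sin (t * Y x)))
        = (CLINT x|M. (iexp (t * Y x) - iexp (- t * Y x)) / (2 * \<i>))"
      by (simp add: sin_eq flip: integral_complex_of_real)
    also have "\<dots> = ((CLINT x|M. iexp (t * Y x)) - (CLINT x|M. iexp (- t * Y x))) / (2 * \<i>)"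
      using int1[of t] int1[of "- t"] by (simp del: of_real_mult of_real_minus mult_minus_left)
    finally have *: "complex_of_real (expectation (\<lambda>x. sin (t * Y x)))
        = ((CLINT x|M. iexp (t * Y x)) - (CLINT x|M. iexp (- t * Y x))) / (2 * \<i>)" .
    have "(CLINT x|M. sin (t * Y x) * iexp (s * X x))
        = (CLINT x|M. (iexp (t * Y x) * iexp (s * X x) - iexp (- t * Y x) * iexp (s * X x)) / (2 * \<i>))"
      by (simp only: sin_eq left_diff_distrib times_divide_eq_left mult_minus_left)
    also have "\<dots> = ((CLINT x|M. iexp (t * Y x) * iexp (s * X x))
        - (CLINT x|M. iexp (- t * Y x) * iexp (s * X x))) / (2 * \<i>)"
      using int2[of t s] int2[of "- t" s] by (simp del: of_real_mult of_real_minus mult_minus_left)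
    finally show ?thesis unfolding fac' * by (simp only: left_diff_distrib times_divide_eq_left)
  qed
  have int3: "integrable M (\<lambda>x. complex_of_real (cos (t * Y x)) * iexp (s * X x))"
    "integrable M (\<lambda>x. complex_of_real (sin (t * Y x)) * iexp (s * X x))" for s t
    by (auto intro!: integrable_const_bound[where B=1] simp: norm_mult simp del: of_real_mult)
  \<comment> \<open>Adding 1 makes the weights nonnegative, as the weight lemma demands; the added
    constant factorizes trivially.\<close>
  have c1: "(CLINT x|M. (1 + cos (t * Y x)) * iexp (s * X x))
        = expectation (\<lambda>x. 1 + cos (t * Y x)) * (CLINT x|M. iexp (s * X x))"
   and c2: "(CLINT x|M. (1 + sin (t * Y x)) * iexp (s * X x))
        = expectation (\<lambda>x. 1 + sin (t * Y x)) * (CLINT x|M. iexp (s * X x))" for s t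
    using int3[of t s] intc[of t] iexp_integrable[of "\<lambda>x. s * X x"]
    by (simp_all add: distrib_right cos_fac sin_fac prob_space del: of_real_mult)
  have nonneg: "0 \<le> 1 + cos y" "0 \<le> 1 + sin y" for y :: real
    using cos_ge_minus_one[of y] sin_ge_minus_one[of y] by linarith+
  \<comment> \<open>After the weight lemma has been applied to the shifted weights, the contribution
    of the constant 1 is subtracted again.\<close>
  have e1: "expectation (\<lambda>x. cos (t * Y x) * indicator A (X x))
      = expectation (\<lambda>x. cos (t * Y x)) * expectation (\<lambda>x. indicator A (X x))"
    and e2: "expectation (\<lambda>x. sin (t * Y x) * indicator A (X x))
      = expectation (\<lambda>x. sin (t * Y x)) * expectation (\<lambda>x. indicator A (X x))"
    if [measurable]: "A \<in> sets borel" for A t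
  proof -
    have i0: "integrable M (\<lambda>x. indicator A (X x) :: real)"
      "integrable M (\<lambda>x. cos (t * Y x) * indicator A (X x))"
      "integrable M (\<lambda>x. sin (t * Y x) * indicator A (X x))"
      by (auto intro!: integrable_const_bound[where B=1] simp: abs_mult indicator_def)
    have "expectation (\<lambda>x. (1 + cos (t * Y x)) * indicator A (X x))
        = expectation (\<lambda>x. 1 + cos (t * Y x)) * expectation (\<lambda>x. indicator A (X x))"
      using intc
      by (intro weight_uncorrelated_events that c1) (auto simp: nonneg)
    then show "expectation (\<lambda>x. cos (t * Y x) * indicator A (X x))
      = expectation (\<lambda>x. cos (t * Y x)) * expectation (\<lambda>x. indicator A (X x))"
      using i0 intc by (simp add: distrib_right prob_space del: integral_indicator)
    have "expectation (\<lambda>x. (1 + sin (t * Y x)) * indicator A (X x))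
        = expectation (\<lambda>x. 1 + sin (t * Y x)) * expectation (\<lambda>x. indicator A (X x))"
      using intc
      by (intro weight_uncorrelated_events that c2) (auto simp: nonneg)
    then show "expectation (\<lambda>x. sin (t * Y x) * indicator A (X x))
      = expectation (\<lambda>x. sin (t * Y x)) * expectation (\<lambda>x. indicator A (X x))"
      using i0 intc by (simp add: distrib_right prob_space del: integral_indicator)
  qed
  have ind: "prob (X -` A \<inter> space M \<inter> (Y -` B \<inter> space M)) = prob (X -` A \<inter> space M) * prob (Y -` B \<inter> space M)"
    if [measurable]: "A \<in> sets borel" "B \<in> sets borel" for A B
  proof -
    have iexp_split: "iexp y = complex_of_real (cos y) + \<i> * complex_of_real (sin y)" for y
      by (simp add: cos_of_real sin_of_real exp_Euler)
    have i0: "integrable M (\<lambda>x. indicator A (X x) :: real)"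
      "integrable M (\<lambda>x. indicator A (X x) * cos (t * Y x))"
      "integrable M (\<lambda>x. indicator A (X x) * sin (t * Y x))" for t
      by (auto intro!: integrable_const_bound[where B=1] simp: abs_mult indicator_def)
    \<comment> \<open>This prepares the second pass of the weight lemma with the roles exchanged:
      the weight is the indicator of \<open>A\<close> at \<open>X\<close>, and the law of
      \<open>Y\<close> is tested. Euler's formula assembles it from \<open>e1\<close> and
      \<open>e2\<close>.\<close>
    have "(CLINT x|M. of_real (indicator A (X x)) * iexp (t * Y x))
      = of_real (expectation (\<lambda>x. indicator A (X x))) * (CLINT x|M. iexp (t * Y x))" for t
    proof -
      have "(CLINT x|M. of_real (indicator A (X x)) * iexp (t * Y x))
        = (CLINT x|M. of_real (indicator A (X x) * cos (t * Y x)) + \<i> * of_real (indicator A (X x) * sin (t * Y x)))"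
        by (intro Bochner_Integration.integral_cong) (simp_all only: iexp_split, simp_all add: algebra_simps)
      also have "\<dots> = of_real (expectation (\<lambda>x. indicator A (X x) * cos (t * Y x)))
          + \<i> * of_real (expectation (\<lambda>x. indicator A (X x) * sin (t * Y x)))"
        using i0 by (subst Bochner_Integration.integral_add) (auto simp del: of_real_mult)
      also have "\<dots> = of_real (expectation (\<lambda>x. indicator A (X x))) *
          (of_real (expectation (\<lambda>x. cos (t * Y x))) + \<i> * of_real (expectation (\<lambda>x. sin (t * Y x))))"
        using e1[OF that(1), of t] e2[OF that(1), of t]
        by (simp add: mult.commute distrib_left mult.left_commute)
      also have "of_real (expectation (\<lambda>x. cos (t * Y x))) + \<i> * of_real (expectation (\<lambda>x. sin (t * Y x)))
          = (CLINT x|M. of_real (cos (t * Y x)) + \<i> * of_real (sin (t * Y x)))"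
        using intc by (subst Bochner_Integration.integral_add) auto
      also have "\<dots> = (CLINT x|M. iexp (t * Y x))"
        by (simp only: iexp_split)
      finally show ?thesis .
    qed
    with i0 have "expectation (\<lambda>x. indicat_real A (X x) * indicat_real B (Y x))
        = expectation (\<lambda>x. indicat_real A (X x)) * expectation (\<lambda>x. indicat_real B (Y x))"
      by (intro weight_uncorrelated_events that Y) auto
    moreover have "expectation (\<lambda>x. indicat_real A (X x) * indicat_real B (Y x))
        = expectation (indicator (X -` A \<inter> space M \<inter> (Y -` B \<inter> space M)))"
      "expectation (\<lambda>x. indicat_real A (X x)) = expectation (indicator (X -` A \<inter> space M))"
      "expectation (\<lambda>x. indicat_real B (Y x)) = expectation (indicator (Y -` B \<inter> space M))"
      by (rule Bochner_Integration.integral_cong, simp, simp add: indicator_def)+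
    ultimately show ?thesis by simp
  qed
  \<comment> \<open>Preimages of Borel sets are closed under intersection, so the product rule
    extends from them to the generated sigma-algebras.\<close>
  have stable: "Int_stable {Z -` A \<inter> space M |A. A \<in> sets borel}" for Z :: "'a \<Rightarrow> real"
    unfolding Int_stable_def
    by auto (metis Int_assoc Int_commute Int_left_absorb sets.Int vimage_Int)
  have "indep_set {X -` A \<inter> space M |A. A \<in> sets borel} {Y -` A \<inter> space M |A. A \<in> sets borel}"
    unfolding indep_sets2_eq using ind by (auto intro: measurable_sets)
  then show ?thesis
    unfolding indep_var_eq by (intro conjI X Y indep_set_sigma_sets stable)
qed

end

subsection \<open>Covariance\<close>

text \<open>This is the scalar form of an entry of \<open>cov_matrix\<close>, so matrix entries
  unfold to it directly.\<close>

definition covariance :: "'a measure \<Rightarrow> ('a \<Rightarrow> real) \<Rightarrow> ('a \<Rightarrow> real) \<Rightarrow> real" where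
  "covariance M X Y = (\<integral>x. (X x - (\<integral>y. X y \<partial>M)) * (Y x - (\<integral>y. Y y \<partial>M)) \<partial>M)"

text \<open>Measurability is demanded of \<open>X\<close> itself, since measurability of the square
  does not imply it and sums and products rely on it.\<close>

definition square_integrable :: "'a measure \<Rightarrow> ('a \<Rightarrow> real) \<Rightarrow> bool" where
  "square_integrable M X \<longleftrightarrow> X \<in> borel_measurable M \<and> integrable M (\<lambda>x. (X x)\<^sup>2)"

lemma covariance_commute: "covariance M X Y = covariance M Y X"
  by (simp add: covariance_def mult.commute)

text \<open>The product is dominated by the sum of the two squares.\<close>

lemma square_integrable_mult:
  assumes "square_integrable M X" "square_integrable M Y"
  shows "integrable M (\<lambda>x. X x * Y x)"
proof (rule Bochner_Integration.integrable_bound)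
  show "integrable M (\<lambda>x. (X x)\<^sup>2 + (Y x)\<^sup>2)" "(\<lambda>x. X x * Y x) \<in> borel_measurable M"
    using assms by (auto simp: square_integrable_def)
  have "\<bar>a * b\<bar> \<le> a\<^sup>2 + b\<^sup>2" for a b :: real
  proof -
    have "2 * \<bar>a * b\<bar> \<le> a\<^sup>2 + b\<^sup>2"
      using sum_squares_bound[of "\<bar>a\<bar>" "\<bar>b\<bar>"] by (simp add: abs_mult)
    then show ?thesis by linarith
  qed
  then show "AE x in M. norm (X x * Y x) \<le> norm ((X x)\<^sup>2 + (Y x)\<^sup>2)" by simp
qed

lemma square_integrable_add:
  assumes "square_integrable M X" "square_integrable M Y"
  shows "square_integrable M (\<lambda>x. X x + Y x)"
  using assms square_integrable_mult[OF assms]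
  by (auto simp: square_integrable_def power2_sum mult.assoc)

lemma square_integrable_cmult:
  "square_integrable M X \<Longrightarrow> square_integrable M (\<lambda>x. k * X x)"
  by (auto simp: square_integrable_def power_mult_distrib)

lemma square_integrable_diff:
  assumes "square_integrable M X" "square_integrable M Y"
  shows "square_integrable M (\<lambda>x. X x - Y x)"
  using square_integrable_add[OF assms(1) square_integrable_cmult[OF assms(2), of "-1"]] by simp

lemma square_integrable_sum:
  "(\<And>i. i \<in> I \<Longrightarrow> square_integrable M (X i)) \<Longrightarrow> square_integrable M (\<lambda>x. \<Sum>i\<in>I. X i x)"
  by (induction I rule: infinite_finite_induct)
    (auto intro: square_integrable_add simp: square_integrable_def[of M "\<lambda>x. 0"])

context prob_space
begin

lemma square_integrable_const: "square_integrable M (\<lambda>x. k)"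
  by (simp add: square_integrable_def)

lemma square_integrable_integrable: "square_integrable M X \<Longrightarrow> integrable M X"
  by (auto simp: square_integrable_def intro: square_integrable_imp_integrable)

text \<open>The centring is expanded once here; bilinearity then follows from linearity of the
  integral.\<close>

lemma covariance_eq:
  assumes "square_integrable M X" "square_integrable M Y"
  shows "covariance M X Y = expectation (\<lambda>x. X x * Y x) - expectation X * expectation Y"
proof -
  note [simp] = assms[THEN square_integrable_integrable] square_integrable_mult[OF assms]
  have "covariance M X Y = expectation (\<lambda>x. X x * Y x - expectation X * Y x
      - expectation Y * X x + expectation X * expectation Y)"
    unfolding covariance_def by (intro Bochner_Integration.integral_cong) (auto simp: algebra_simps)
  then show ?thesis by (simp add: prob_space)
qed

lemma covariance_add_left:
  assumes "square_integrable M X" "square_integrable M Y" "square_integrable M Z"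
  shows "covariance M (\<lambda>x. X x + Y x) Z = covariance M X Z + covariance M Y Z"
  using assms
  by (simp add: covariance_eq square_integrable_add square_integrable_integrable
      square_integrable_mult distrib_right)

lemma covariance_diff_left:
  assumes "square_integrable M X" "square_integrable M Y" "square_integrable M Z"
  shows "covariance M (\<lambda>x. X x - Y x) Z = covariance M X Z - covariance M Y Z"
  using assms
  by (simp add: covariance_eq square_integrable_diff square_integrable_integrable
      square_integrable_mult left_diff_distrib)

lemma covariance_cmult_left:
  assumes "square_integrable M X" "square_integrable M Z"
  shows "covariance M (\<lambda>x. k * X x) Z = k * covariance M X Z"
  using assms
  by (simp add: covariance_eq square_integrable_cmult mult.assoc right_diff_distrib)

lemma covariance_add_right:
  assumes "square_integrable M X" "square_integrable M Y" "square_integrable M Z"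
  shows "covariance M Z (\<lambda>x. X x + Y x) = covariance M Z X + covariance M Z Y"
  using covariance_add_left[OF assms] by (simp add: covariance_commute)

lemma covariance_diff_right:
  assumes "square_integrable M X" "square_integrable M Y" "square_integrable M Z"
  shows "covariance M Z (\<lambda>x. X x - Y x) = covariance M Z X - covariance M Z Y"
  using covariance_diff_left[OF assms] by (simp add: covariance_commute)

lemma covariance_cmult_right:
  assumes "square_integrable M X" "square_integrable M Z"
  shows "covariance M Z (\<lambda>x. k * X x) = k * covariance M Z X"
  using covariance_cmult_left[OF assms] by (simp add: covariance_commute)

lemma covariance_const_left: "covariance M (\<lambda>x. k) Z = 0"
  by (simp add: covariance_def prob_space)

lemma covariance_const_right: "covariance M Z (\<lambda>x. k) = 0"
  by (simp add: covariance_def prob_space)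

lemma covariance_sum_left:
  assumes "\<And>i. i \<in> I \<Longrightarrow> square_integrable M (X i)" "square_integrable M Z"
  shows "covariance M (\<lambda>x. \<Sum>i\<in>I. X i x) Z = (\<Sum>i\<in>I. covariance M (X i) Z)"
  using assms
  by (induction I rule: infinite_finite_induct)
    (simp_all add: covariance_const_left covariance_add_left square_integrable_sum)

lemma covariance_sum_right:
  assumes "\<And>i. i \<in> I \<Longrightarrow> square_integrable M (X i)" "square_integrable M Z"
  shows "covariance M Z (\<lambda>x. \<Sum>i\<in>I. X i x) = (\<Sum>i\<in>I. covariance M Z (X i))"
  using covariance_sum_left[OF assms] by (simp add: covariance_commute)

lemma variance_eq_covariance: "variance X = covariance M X X"
  by (simp add: covariance_def power2_eq_square)

lemma covariance_indep:
  fixes X Y :: "'a \<Rightarrow> real"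
  assumes "indep_var borel X borel Y" "square_integrable M X" "square_integrable M Y"
  shows "covariance M X Y = 0"
  using assms by (simp add: covariance_eq indep_var_lebesgue_integral square_integrable_integrable)

text \<open>Bilinearity expands both matrix-vector products over the components of \<open>Z\<close>;
  this is the bridge from covariances to the matrix expressions of the closed forms.\<close>

lemma covariance_matrix_vector:
  fixes Z :: "'a \<Rightarrow> real ^ 'n" and K :: "real ^ 'n ^ 'm" and L :: "real ^ 'n ^ 'k"
  assumes Z: "\<And>i. square_integrable M (\<lambda>x. Z x $ i)"
  shows "covariance M (\<lambda>x. (K *v Z x) $ i) (\<lambda>x. (L *v Z x) $ j)
    = (K ** cov_matrix M Z ** transpose L) $ i $ j"
proof -
  have "covariance M (\<lambda>x. (K *v Z x) $ i) (\<lambda>x. (L *v Z x) $ j)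
    = (\<Sum>a\<in>UNIV. \<Sum>b\<in>UNIV. K $ i $ a * (L $ j $ b * covariance M (\<lambda>x. Z x $ a) (\<lambda>x. Z x $ b)))"
    by (simp add: matrix_vector_mult_def covariance_sum_left covariance_sum_right covariance_cmult_left
        covariance_cmult_right square_integrable_sum square_integrable_cmult Z)
  \<comment> \<open>In the matrix product the outer summation index belongs to
    \<open>transpose L\<close>.\<close>
  also have "\<dots> = (\<Sum>b\<in>UNIV. \<Sum>a\<in>UNIV. K $ i $ a * (L $ j $ b * covariance M (\<lambda>x. Z x $ a) (\<lambda>x. Z x $ b)))"
    by (rule sum.swap)
  also have "\<dots> = (K ** cov_matrix M Z ** transpose L) $ i $ j"
    by (simp add: matrix_matrix_mult_def transpose_def cov_matrix_def covariance_def
        sum_distrib_left sum_distrib_right mult.commute mult.left_commute)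
  finally show ?thesis .
qed

lemma square_integrable_matrix_vector:
  fixes Z :: "'a \<Rightarrow> real ^ 'n" and K :: "real ^ 'n ^ 'm"
  assumes "\<And>i. square_integrable M (\<lambda>x. Z x $ i)"
  shows "square_integrable M (\<lambda>x. (K *v Z x) $ i)"
  using assms by (simp add: matrix_vector_mult_def square_integrable_sum square_integrable_cmult)

subsection \<open>Regression of one component of a Gaussian pair on the other\<close>

lemma gaussian_rv_square_integrable:
  fixes X :: "'a \<Rightarrow> real"
  assumes "gaussian_rv M X"
  shows "square_integrable M X"
  using gaussian_rv_realE[OF assms] assms by (auto simp: square_integrable_def gaussian_rv_def)

lemma gaussian_rv_pair_combination:
  fixes X Y :: "'a \<Rightarrow> real"
  assumes "gaussian_rv M (\<lambda>x. (X x, Y x))"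
  shows "gaussian_rv M (\<lambda>x. s * X x + t * Y x)"
proof -
  have "linear (\<lambda>p. s * fst p + t * snd p :: real)"
    by (intro linearI) (auto simp: algebra_simps)
  from gaussian_rv_linear[OF assms this] show ?thesis by simp
qed

text \<open>The joint characteristic function has the variance of \<open>s X + t Y\<close> in its
  exponent. The only mixed term there is a multiple of the covariance, so without it the function
  splits into its marginals.\<close>

theorem gaussian_uncorrelated_indep:
  fixes X Y :: "'a \<Rightarrow> real"
  assumes G: "gaussian_rv M (\<lambda>x. (X x, Y x))" and cov: "covariance M X Y = 0"
  shows "indep_var borel X borel Y"
proof (rule indep_var_if_iexp_factorizes)
  note comb = gaussian_rv_pair_combination[OF G]
  from comb[of 1 0] comb[of 0 1] have X: "gaussian_rv M X" and Y: "gaussian_rv M Y" by simp_all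
  then show "X \<in> borel_measurable M" "Y \<in> borel_measurable M" by (simp_all add: gaussian_rv_def)
  note si = gaussian_rv_square_integrable[OF X] gaussian_rv_square_integrable[OF Y]
  fix s t
  have "(CLINT x|M. iexp (s * X x)) = iexp (s * expectation X) * exp (- (s\<^sup>2 * covariance M X X) / 2)"
    using gaussian_rv_iexp[unfolded variance_eq_covariance, OF comb[of s 0]] si
    by (simp add: covariance_cmult_left covariance_cmult_right
        square_integrable_cmult power2_eq_square mult.assoc)
  moreover have "(CLINT x|M. iexp (t * Y x)) = iexp (t * expectation Y) * exp (- (t\<^sup>2 * covariance M Y Y) / 2)"
    using gaussian_rv_iexp[unfolded variance_eq_covariance, OF comb[of 0 t]] si
    by (simp add: covariance_cmult_left covariance_cmult_right
        square_integrable_cmult power2_eq_square mult.assoc)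
  moreover have "(CLINT x|M. iexp (s * X x + t * Y x))
      = iexp (s * expectation X + t * expectation Y) * exp (- (s\<^sup>2 * covariance M X X + t\<^sup>2 * covariance M Y Y) / 2)"
    using gaussian_rv_iexp[unfolded variance_eq_covariance, OF comb[of s t]] si cov covariance_commute[of M X Y]
    by (simp add: covariance_cmult_left covariance_cmult_right
        covariance_add_left covariance_add_right square_integrable_add square_integrable_integrable
        square_integrable_cmult power2_eq_square mult.assoc)
  moreover have "exp (- (p + q) / 2) = exp (- p / 2) * exp (- q / 2)" for p q :: real
    by (simp add: exp_add[symmetric] field_simps)
  ultimately show "(CLINT x|M. iexp (s * X x + t * Y x))
      = (CLINT x|M. iexp (s * X x)) * (CLINT x|M. iexp (t * Y x))"
    by (simp only: exp_add of_real_add of_real_mult distrib_left ac_simps)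
qed

text \<open>The coefficient \<open>k\<close> is the one that makes the residual uncorrelated with
  \<open>Y\<close>. The pair of residual and \<open>Y\<close> is a linear image of the Gaussian
  pair, so it is Gaussian again and uncorrelatedness gives independence.\<close>

lemma gaussian_regression:
  fixes X Y :: "'a \<Rightarrow> real"
  assumes G: "gaussian_rv M (\<lambda>x. (X x, Y x))" and v: "covariance M Y Y \<noteq> 0"
  defines "k \<equiv> covariance M X Y / covariance M Y Y"
  shows "gaussian_rv M (\<lambda>x. X x - k * Y x)"
    and "indep_var borel (\<lambda>x. X x - k * Y x) borel Y"
    and "variance (\<lambda>x. X x - k * Y x) = covariance M X X - (covariance M X Y)\<^sup>2 / covariance M Y Y"
proof -
  note comb = gaussian_rv_pair_combination[OF G]
  show R: "gaussian_rv M (\<lambda>x. X x - k * Y x)" using comb[of 1 "- k"] by simp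
  from comb[of 1 0] comb[of 0 1] have X: "gaussian_rv M X" and Y: "gaussian_rv M Y" by simp_all
  note si = gaussian_rv_square_integrable[OF X] gaussian_rv_square_integrable[OF Y]
  note cs = covariance_diff_left covariance_diff_right covariance_cmult_left covariance_cmult_right
    square_integrable_diff square_integrable_cmult si
  have "covariance M (\<lambda>x. X x - k * Y x) Y = covariance M X Y - k * covariance M Y Y"
    by (simp add: cs)
  with v have cov: "covariance M (\<lambda>x. X x - k * Y x) Y = 0" by (simp add: k_def)
  have "linear (\<lambda>p. (fst p - k * snd p, snd p) :: real \<times> real)"
    by (intro linearI) (auto simp: algebra_simps)
  from gaussian_rv_linear[OF G this] have "gaussian_rv M (\<lambda>x. (X x - k * Y x, Y x))" by simp
  from gaussian_uncorrelated_indep[OF this cov]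
  show "indep_var borel (\<lambda>x. X x - k * Y x) borel Y" .
  have "variance (\<lambda>x. X x - k * Y x)
      = covariance M X X - 2 * k * covariance M X Y + k\<^sup>2 * covariance M Y Y"
    unfolding variance_eq_covariance
    by (simp add: cs covariance_commute[of M Y X] power2_eq_square algebra_simps)
  then show "variance (\<lambda>x. X x - k * Y x) = covariance M X X - (covariance M X Y)\<^sup>2 / covariance M Y Y"
    using v by (simp add: k_def power2_eq_square field_simps)
qed

end

subsection \<open>Conditional covariance and conditional entropy of a Gaussian pair\<close>

context prob_space
begin

lemma sigma_finite_subalgebra_vimage:
  fixes Y :: "'a \<Rightarrow> real"
  assumes "Y \<in> borel_measurable M"
  shows "sigma_finite_subalgebra M (vimage_algebra (space M) Y borel)"
proof (rule finite_measure_subalgebra_is_sigma_finite)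
  show "finite_measure_subalgebra M (vimage_algebra (space M) Y borel)"
    using assms
    by unfold_locales (auto simp: subalgebra_def sets_vimage_algebra2 intro: measurable_sets)
qed

lemma real_cond_exp_indep:
  fixes R Y :: "'a \<Rightarrow> real"
  assumes ind: "indep_var borel R borel Y" and R: "integrable M R"
  shows "AE x in M. real_cond_exp M (vimage_algebra (space M) Y borel) R x = expectation R"
proof -
  have Y[measurable]: "Y \<in> borel_measurable M" using ind by (rule indep_var_rv2)
  interpret F: sigma_finite_subalgebra M "vimage_algebra (space M) Y borel"
    by (rule sigma_finite_subalgebra_vimage) (rule Y)
  show ?thesis
  proof (rule F.real_cond_exp_charact)
    fix A assume "A \<in> sets (vimage_algebra (space M) Y borel)"
    then obtain B where B[measurable]: "B \<in> sets borel" and A: "A = Y -` B \<inter> space M"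
      by (auto simp: sets_vimage_algebra2)
    have ind': "indep_var borel R borel (\<lambda>x. indicator B (Y x) :: real)"
      using indep_var_compose[OF ind, of "\<lambda>x. x" borel "indicator B :: real \<Rightarrow> real" borel]
      by (simp add: comp_def)
    have iB: "integrable M (\<lambda>x. indicator B (Y x) :: real)"
      by (auto intro!: integrable_const_bound[where B=1] simp: indicator_def)
    have "(LINT x:A|M. R x) = expectation (\<lambda>x. R x * indicator B (Y x))"
      unfolding set_lebesgue_integral_def A
      by (rule Bochner_Integration.integral_cong) (auto simp: indicator_def)
    also have "\<dots> = expectation R * expectation (\<lambda>x. indicator B (Y x))"
      by (rule indep_var_lebesgue_integral[OF ind' R iB])
    also have "\<dots> = expectation (\<lambda>x. expectation R * indicator B (Y x))"
      using iB by (simp del: integral_indicator)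
    also have "\<dots> = (LINT x:A|M. expectation R)"
      unfolding set_lebesgue_integral_def A
      by (rule Bochner_Integration.integral_cong) (auto simp: indicator_def)
    finally show "(LINT x:A|M. R x) = (LINT x:A|M. expectation R)" .
  qed (use R in auto)
qed

text \<open>The conditional mean of \<open>X\<close> is \<open>expectation R + k * Y\<close>, so the
  deviation from it is the centred residual. Its square is independent of \<open>Y\<close>, and
  conditioning returns its plain expectation.\<close>

lemma cond_cov_indep_residual:
  fixes X Y :: "'a \<Rightarrow> real"
  assumes ind: "indep_var borel (\<lambda>x. X x - k * Y x) borel Y"
    and X: "square_integrable M X" and Y: "square_integrable M Y"
  shows "AE x in M. cond_cov M X Y x = variance (\<lambda>x. X x - k * Y x)"
proof -
  define R where "R = (\<lambda>x. X x - k * Y x)"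
  have R: "square_integrable M R"
    unfolding R_def by (intro square_integrable_diff square_integrable_cmult X Y)
  have [measurable]: "X \<in> borel_measurable M" "Y \<in> borel_measurable M" "R \<in> borel_measurable M"
    using X Y R by (auto simp: square_integrable_def)
  note [simp] = X[THEN square_integrable_integrable] Y[THEN square_integrable_integrable]
    R[THEN square_integrable_integrable]
  let ?F = "vimage_algebra (space M) Y borel"
  interpret F: sigma_finite_subalgebra M ?F
    by (rule sigma_finite_subalgebra_vimage) measurable
  have Y_F: "Y \<in> borel_measurable ?F" by (rule measurable_vimage_algebra1) simp
  have X_eq: "X x = R x + k * Y x" for x by (simp add: R_def)
  have "(\<lambda>x. R x + k * Y x) = X" by (simp add: R_def)
  with F.real_cond_exp_add[of R "\<lambda>x. k * Y x"]
  have "AE x in M. real_cond_exp M ?F X x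
      = real_cond_exp M ?F R x + real_cond_exp M ?F (\<lambda>x. k * Y x) x" by simp
  moreover have "AE x in M. real_cond_exp M ?F (\<lambda>x. k * Y x) x = k * Y x"
    by (rule F.real_cond_exp_F_meas) (use Y_F in auto)
  moreover have "AE x in M. real_cond_exp M ?F R x = expectation R"
    by (rule real_cond_exp_indep[OF ind[folded R_def]]) simp
  ultimately have ae: "AE x in M. (X x - real_cond_exp M ?F X x)\<^sup>2 = (R x - expectation R)\<^sup>2"
  proof eventually_elim
    case (elim x)
    then have "X x - real_cond_exp M ?F X x = R x - expectation R"
      using X_eq[of x] by linarith
    then show ?case by (rule arg_cong)
  qed
  have "AE x in M. real_cond_exp M ?F (\<lambda>x. (X x - real_cond_exp M ?F X x)\<^sup>2) x
      = real_cond_exp M ?F (\<lambda>x. (R x - expectation R)\<^sup>2) x"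
    by (rule F.real_cond_exp_cong[OF ae]) measurable
  moreover have "AE x in M. real_cond_exp M ?F (\<lambda>x. (R x - expectation R)\<^sup>2) x = variance R"
  proof (rule real_cond_exp_indep)
    show "indep_var borel (\<lambda>x. (R x - expectation R)\<^sup>2) borel Y"
      by (rule indep_var_compose[OF ind[folded R_def], unfolded comp_def,
            where ?Y1.0 = "\<lambda>r. (r - expectation R)\<^sup>2" and ?Y2.0 = "\<lambda>y. y"]) measurable
    show "integrable M (\<lambda>x. (R x - expectation R)\<^sup>2)"
      using square_integrable_diff[OF R square_integrable_const[of "expectation R"]]
      unfolding square_integrable_def by blast
  qed
  ultimately have "AE x in M. cond_cov M X Y x = variance R"
    unfolding cond_cov_def Let_def by eventually_elim simp
  then show ?thesis unfolding R_def .
qed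

text \<open>The residual and \<open>Y\<close> have a product density, and \<open>(r, y)\<close> is
  sent to \<open>(r + k y, y)\<close> by a shear, which preserves Lebesgue measure on the
  plane.\<close>

lemma distributed_affine_residual:
  fixes X Y :: "'a \<Rightarrow> real"
  assumes R: "distributed M lborel (\<lambda>x. X x - k * Y x) f" and Y: "distributed M lborel Y g"
    and ind: "indep_var borel (\<lambda>x. X x - k * Y x) borel Y"
  shows "distributed M (lborel \<Otimes>\<^sub>M lborel) (\<lambda>x. (X x, Y x)) (\<lambda>(x, y). f (x - k * y) * g y)"
proof -
  let ?R = "\<lambda>x. X x - k * Y x"
  have [measurable]: "f \<in> borel_measurable borel" "g \<in> borel_measurable borel"
    using R Y by (auto dest: distributed_borel_measurable)
  have [measurable]: "?R \<in> borel_measurable M" "Y \<in> borel_measurable M"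
    using R Y by (auto dest!: distributed_measurable)
  have "(\<lambda>x. ?R x + k * Y x) \<in> borel_measurable M" by measurable
  then have X[measurable]: "X \<in> borel_measurable M" by simp
  have ind': "indep_var lborel ?R lborel Y"
    using ind unfolding indep_var_eq by simp
  have RY: "distributed M (lborel \<Otimes>\<^sub>M lborel) (\<lambda>x. (?R x, Y x)) (\<lambda>(x, y). f x * g y)"
    by (rule distributed_joint_indep[OF _ _ R Y ind']) (rule sigma_finite_lborel)+
  show ?thesis
    unfolding distributed_def
  proof (intro conjI measure_eqI)
    show "sets (distr M (lborel \<Otimes>\<^sub>M lborel) (\<lambda>x. (X x, Y x)))
        = sets (density (lborel \<Otimes>\<^sub>M lborel) (\<lambda>(x, y). f (x - k * y) * g y))" by simp
    show "(\<lambda>x. (X x, Y x)) \<in> M \<rightarrow>\<^sub>M lborel \<Otimes>\<^sub>M lborel" by measurable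
    show dens: "(\<lambda>(x, y). f (x - k * y) * g y) \<in> borel_measurable (lborel \<Otimes>\<^sub>M lborel)"
      by measurable
    fix A assume "A \<in> sets (distr M (lborel \<Otimes>\<^sub>M lborel) (\<lambda>x. (X x, Y x)))"
    then have A: "A \<in> sets (lborel \<Otimes>\<^sub>M lborel)" by simp
    also have "sets (lborel \<Otimes>\<^sub>M lborel) = sets (borel \<Otimes>\<^sub>M borel :: (real \<times> real) measure)"
      by (intro sets_pair_measure_cong) simp_all
    finally have [measurable]: "A \<in> sets (borel \<Otimes>\<^sub>M borel)" .
    \<comment> \<open>\<open>F\<close> is the integrand in residual coordinates, \<open>G\<close>
      the same integrand in the original ones.\<close>
    define F where "F = (\<lambda>p. f (fst p) * g (snd p) * indicator A (fst p + k * snd p, snd p))"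
    define G where "G = (\<lambda>p. f (fst p - k * snd p) * g (snd p) * indicator A p)"
    have F: "F \<in> borel_measurable (lborel \<Otimes>\<^sub>M lborel)" unfolding F_def by measurable
    have G: "G \<in> borel_measurable (lborel \<Otimes>\<^sub>M lborel)" unfolding G_def by measurable
    have XY: "(\<lambda>x. (X x, Y x)) \<in> M \<rightarrow>\<^sub>M lborel \<Otimes>\<^sub>M lborel" by measurable
    have "emeasure (distr M (lborel \<Otimes>\<^sub>M lborel) (\<lambda>x. (X x, Y x))) A
        = (\<integral>\<^sup>+p. indicator A p \<partial>distr M (lborel \<Otimes>\<^sub>M lborel) (\<lambda>x. (X x, Y x)))"
      using A by (intro nn_integral_indicator[symmetric]) simp
    also have "\<dots> = (\<integral>\<^sup>+w. indicator A (X w, Y w) \<partial>M)"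
      using A by (intro nn_integral_distr[OF XY] borel_measurable_indicator) simp
    also have "\<dots> = (\<integral>\<^sup>+w. (\<lambda>p. indicator A (fst p + k * snd p, snd p)) (?R w, Y w) \<partial>M)" by simp
    also have "\<dots> = (\<integral>\<^sup>+p. (\<lambda>(x, y). f x * g y) p * indicator A (fst p + k * snd p, snd p) \<partial>(lborel \<Otimes>\<^sub>M lborel))"
      by (rule distributed_nn_integral[OF RY, symmetric]) measurable
    also have "\<dots> = integral\<^sup>N (lborel \<Otimes>\<^sub>M lborel) F"
      by (simp only: F_def split_beta')
    also have "\<dots> = (\<integral>\<^sup>+y. \<integral>\<^sup>+r. F (r, y) \<partial>lborel \<partial>lborel)"
      by (rule lborel_pair.nn_integral_snd[OF F, symmetric])
    also have "\<dots> = (\<integral>\<^sup>+y. \<integral>\<^sup>+x. G (x, y) \<partial>lborel \<partial>lborel)"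
    proof (rule nn_integral_cong)
      fix y
      \<comment> \<open>For fixed \<open>y\<close> the substitution \<open>r = x - k y\<close> is a
        translation; the scale 1 contributes the trivial Jacobian.\<close>
      have "(\<lambda>r. F (r, y)) \<in> borel_measurable borel" unfolding F_def fst_conv snd_conv by measurable
      then have "(\<integral>\<^sup>+r. F (r, y) \<partial>lborel)
          = ennreal \<bar>1\<bar> * (\<integral>\<^sup>+x. F (- k * y + 1 * x, y) \<partial>lborel)"
        by (rule nn_integral_real_affine) simp
      also have "(\<lambda>x. F (- k * y + 1 * x, y)) = (\<lambda>x. G (x, y))"
        by (simp add: F_def G_def)
      finally show "(\<integral>\<^sup>+r. F (r, y) \<partial>lborel) = (\<integral>\<^sup>+x. G (x, y) \<partial>lborel)"
        by (simp only: abs_one ennreal_1 mult_1)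
    qed
    also have "\<dots> = integral\<^sup>N (lborel \<Otimes>\<^sub>M lborel) G"
      by (rule lborel_pair.nn_integral_snd[OF G])
    also have "\<dots> = (\<integral>\<^sup>+p. (\<lambda>(x, y). f (x - k * y) * g y) p * indicator A p \<partial>(lborel \<Otimes>\<^sub>M lborel))"
      by (simp only: G_def split_beta')
    also have "\<dots> = emeasure (density (lborel \<Otimes>\<^sub>M lborel) (\<lambda>(x, y). f (x - k * y) * g y)) A"
      by (rule emeasure_density[OF dens A, symmetric])
    finally show "emeasure (distr M (lborel \<Otimes>\<^sub>M lborel) (\<lambda>x. (X x, Y x))) A
        = emeasure (density (lborel \<Otimes>\<^sub>M lborel) (\<lambda>(x, y). f (x - k * y) * g y)) A" .
  qed
qed

text \<open>Nonzero variance excludes the point mass in \<open>gaussian_law\<close> and leaves the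
  branch with a density.\<close>

lemma gaussian_rv_distributed:
  fixes X :: "'a \<Rightarrow> real"
  assumes X: "gaussian_rv M X" and v: "variance X \<noteq> 0"
  shows "distributed M lborel X (normal_density (expectation X) (sqrt (variance X)))"
proof -
  have [measurable]: "X \<in> borel_measurable M" using X by (simp add: gaussian_rv_def)
  from gaussian_rv_realE[OF X] obtain s where s: "0 \<le> s"
    and d: "distr M borel X = gaussian_law (expectation X) s" and var: "variance X = s\<^sup>2" by blast
  from v var have "s \<noteq> 0" by auto
  moreover have "distr M lborel X = distr M borel X" by (rule distr_cong) auto
  moreover have "sqrt (variance X) = s" using s by (simp add: var)
  ultimately show ?thesis unfolding distributed_def by (simp add: d gaussian_law_def)
qed

text \<open>Dividing the joint density by that of \<open>Y\<close> leaves
  \<open>f (x - k * y)\<close>, so the conditional entropy is the expectation of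
  \<open>- log b (f R)\<close>, the entropy of the residual \<open>R\<close>.\<close>

lemma conditional_entropy_indep_residual:
  fixes X Y :: "'a \<Rightarrow> real"
  assumes b: "1 < b"
    and R: "gaussian_rv M (\<lambda>x. X x - k * Y x)" and Y: "gaussian_rv M Y"
    and ind: "indep_var borel (\<lambda>x. X x - k * Y x) borel Y"
    and vR: "variance (\<lambda>x. X x - k * Y x) \<noteq> 0" and vY: "variance Y \<noteq> 0"
  shows "diff_cond_entropy b M X Y = log b (2 * pi * exp 1 * variance (\<lambda>x. X x - k * Y x)) / 2"
proof -
  interpret information_space M b by unfold_locales (rule b)
  let ?R = "\<lambda>x. X x - k * Y x"
  define f where "f = normal_density (expectation ?R) (sqrt (variance ?R))"
  define g where "g = normal_density (expectation Y) (sqrt (variance Y))"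
  note dR = gaussian_rv_distributed[OF R vR, folded f_def]
  note dY = gaussian_rv_distributed[OF Y vY, folded g_def]
  have [measurable]: "f \<in> borel_measurable borel" "g \<in> borel_measurable borel"
    by (simp_all add: f_def g_def)
  have vR': "0 < variance ?R" and vY': "0 < variance Y"
    using vR vY by (simp_all add: order.not_eq_order_implies_strict variance_positive)
  \<comment> \<open>Strict positivity everywhere lets the density of \<open>Y\<close> cancel
    pointwise inside the logarithm.\<close>
  have g0: "0 < g y" for y using vY' by (simp add: g_def normal_density_pos)
  have f0: "0 < f y" for y using vR' by (simp add: f_def normal_density_pos)
  have nn: "0 \<le> f x" "0 \<le> g x" "g x \<noteq> 0" for x
    using f0[of x] g0[of x] by auto
  have dXY: "distributed M (lborel \<Otimes>\<^sub>M lborel) (\<lambda>x. (X x, Y x)) (\<lambda>p. ennreal (f (fst p - k * snd p) * g (snd p)))"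
    using distributed_affine_residual[OF dR dY ind]
    by (simp add: split_beta' ennreal_mult' nn)
  have "diff_cond_entropy b M X Y
      = - (\<integral>p. f (fst p - k * snd p) * g (snd p) * log b (f (fst p - k * snd p)) \<partial>(lborel \<Otimes>\<^sub>M lborel))"
    using conditional_entropy_generic_eq[OF sigma_finite_lborel sigma_finite_lborel dY _ dXY]
    by (simp add: split_beta' nn)
  also have "\<dots> = - expectation (\<lambda>x. log b (f (fst (X x, Y x) - k * snd (X x, Y x))))"
    by (subst distributed_integral[OF dXY, symmetric]) (auto simp: nn)
  also have "\<dots> = - expectation (\<lambda>x. log b (f (?R x)))" by simp
  also have "\<dots> = - (\<integral>r. f r * log b (f r) \<partial>lborel)"
    by (subst distributed_integral[OF dR, symmetric]) (auto simp: nn)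
  also have "\<dots> = entropy b lborel ?R"
    by (subst entropy_distr[OF dR]) (auto simp: nn)
  also have "\<dots> = log b (2 * pi * exp 1 * variance ?R) / 2"
    using entropy_normal_density[OF _ dR[unfolded f_def]] vR' by simp
  finally show ?thesis .
qed

text \<open>The name \<open>d\<close> for the residual variance lets a matrix entry be supplied for
  it later. At \<open>d = 0\<close> the residual is almost surely constant and has no density, hence
  the guard on the entropy clause.\<close>

theorem gaussian_pair_conditional:
  fixes X Y :: "'a \<Rightarrow> real"
  assumes b: "1 < b" and G: "gaussian_rv M (\<lambda>x. (X x, Y x))" and v: "covariance M Y Y \<noteq> 0"
    and d: "d = covariance M X X - (covariance M X Y)\<^sup>2 / covariance M Y Y"
  shows "AE x in M. cond_cov M X Y x = d"
    and "d \<noteq> 0 \<Longrightarrow> diff_cond_entropy b M X Y = log b (2 * pi * exp 1 * d) / 2"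
proof -
  note comb = gaussian_rv_pair_combination[OF G]
  from comb[of 1 0] comb[of 0 1] have X: "gaussian_rv M X" and Y: "gaussian_rv M Y" by simp_all
  note reg = gaussian_regression[OF G v, folded d]
  show "AE x in M. cond_cov M X Y x = d"
    using cond_cov_indep_residual[OF reg(2) gaussian_rv_square_integrable[OF X]
        gaussian_rv_square_integrable[OF Y]] by (simp only: reg(3))
  show "diff_cond_entropy b M X Y = log b (2 * pi * exp 1 * d) / 2" if "d \<noteq> 0"
    using conditional_entropy_indep_residual[OF b reg(1) Y reg(2)] that v
    unfolding reg(3) by (simp add: variance_eq_covariance)
qed

end

subsection \<open>A linear Gaussian channel with independent output noise\<close>

context prob_space
begin

text \<open>The system equations hold only on \<open>space M\<close>; this lemma and the next carry
  results across such equalities.\<close>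

lemma gaussian_rv_cong:
  assumes "\<And>x. x \<in> space M \<Longrightarrow> X x = Y x"
  shows "gaussian_rv M X \<longleftrightarrow> gaussian_rv M Y"
proof -
  have "X \<in> borel_measurable M \<longleftrightarrow> Y \<in> borel_measurable M"
    using assms by (rule measurable_cong)
  moreover have "distr M borel (\<lambda>x. v \<bullet> X x) = distr M borel (\<lambda>x. v \<bullet> Y x)" for v
    using assms by (intro distr_cong) auto
  ultimately show ?thesis by (simp add: gaussian_rv_def)
qed

lemma covariance_cong:
  assumes "\<And>x. x \<in> space M \<Longrightarrow> X x = X' x" "\<And>x. x \<in> space M \<Longrightarrow> Y x = Y' x"
  shows "covariance M X Y = covariance M X' Y'"
proof -
  have "expectation X = expectation X'" "expectation Y = expectation Y'"
    using assms by (auto intro: Bochner_Integration.integral_cong)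
  then show ?thesis
    unfolding covariance_def using assms by (intro Bochner_Integration.integral_cong) auto
qed

text \<open>A variance depends on the law alone, so identically distributed noise has one variance
  at all times.\<close>

lemma covariance_self_eq_distr:
  fixes X Y :: "'a \<Rightarrow> real"
  assumes "X \<in> borel_measurable M" "Y \<in> borel_measurable M" "distr M borel X = distr M borel Y"
  shows "covariance M X X = covariance M Y Y"
proof -
  have "covariance M Z Z = (\<integral>r. (r - (\<integral>r. r \<partial>distr M borel Z)) * (r - (\<integral>r. r \<partial>distr M borel Z)) \<partial>distr M borel Z)"
    if "Z \<in> borel_measurable M" for Z :: "'a \<Rightarrow> real"
    using that by (simp add: covariance_def integral_distr)
  with assms show ?thesis by simp
qed

lemma covariance_self_nonneg: "0 \<le> covariance M X X"
  by (simp add: covariance_def)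

text \<open>The sigma-algebra generated by \<open>f (X x)\<close> lies inside the pullback along
  \<open>X\<close>, and likewise for \<open>Y\<close>. This leads from independence of whole
  processes to independence of finitely many coordinates.\<close>

lemma indep_rv_imp_indep_var:
  assumes ind: "indep_rv M N X N' Y"
    and X: "X \<in> space M \<rightarrow> space N" and Y: "Y \<in> space M \<rightarrow> space N'"
    and f: "f \<in> measurable N K" and g: "g \<in> measurable N' L"
  shows "indep_var K (\<lambda>x. f (X x)) L (\<lambda>x. g (Y x))"
proof -
  let ?U = "vimage_algebra (space M) X N" and ?W = "vimage_algebra (space M) Y N'"
  from ind have ind: "sets ?U \<subseteq> events" "sets ?W \<subseteq> events"
    "\<And>a b. a \<in> sets ?U \<Longrightarrow> b \<in> sets ?W \<Longrightarrow> prob (a \<inter> b) = prob a * prob b"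
    unfolding indep_rv_def indep_sets2_eq by auto
  have fX: "(\<lambda>x. f (X x)) \<in> measurable ?U K"
    using measurable_vimage_algebra1[OF X] f by (rule measurable_compose)
  have gY: "(\<lambda>x. g (Y x)) \<in> measurable ?W L"
    using measurable_vimage_algebra1[OF Y] g by (rule measurable_compose)
  have sub: "sigma_sets (space M) {Z -` A \<inter> space M |A. A \<in> sets S} \<subseteq> sets F"
    if "Z \<in> measurable F S" "space F = space M" for Z F and S :: "'z measure"
    using sets.sigma_sets_subset[of "{Z -` A \<inter> space M |A. A \<in> sets S}" F] measurable_sets[OF that(1)]
    by (auto simp: that(2))
  have rv: "Z \<in> measurable M S"
    if "Z \<in> measurable F S" "space F = space M" "sets F \<subseteq> events" for Z F and S :: "'z measure"
    using that by (auto simp: measurable_def)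
  show ?thesis
    unfolding indep_var_eq indep_sets2_eq
  proof (intro conjI ballI)
    show "random_variable K (\<lambda>x. f (X x))" by (rule rv[OF fX _ ind(1)]) simp
    show "random_variable L (\<lambda>x. g (Y x))" by (rule rv[OF gY _ ind(2)]) simp
    note sub_f = sub[OF fX space_vimage_algebra] and sub_g = sub[OF gY space_vimage_algebra]
    show "sigma_sets (space M) {(\<lambda>x. f (X x)) -` A \<inter> space M |A. A \<in> sets K} \<subseteq> events"
      using sub_f ind(1) by (rule subset_trans)
    show "sigma_sets (space M) {(\<lambda>x. g (Y x)) -` A \<inter> space M |A. A \<in> sets L} \<subseteq> events"
      using sub_g ind(2) by (rule subset_trans)
    fix a b
    assume "a \<in> sigma_sets (space M) {(\<lambda>x. f (X x)) -` A \<inter> space M |A. A \<in> sets K}"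
      and "b \<in> sigma_sets (space M) {(\<lambda>x. g (Y x)) -` A \<inter> space M |A. A \<in> sets L}"
    then show "prob (a \<inter> b) = prob a * prob b"
      by (intro ind(3) subsetD[OF sub_f] subsetD[OF sub_g])
  qed
qed

text \<open>The blocks \<open>{i}\<close> and \<open>{j}\<close> are disjoint, and evaluation
  recovers each variable from its block.\<close>

lemma indep_vars_imp_indep_var:
  assumes ind: "indep_vars (\<lambda>_. N) X I" and "i \<in> I" "j \<in> I" "i \<noteq> j"
  shows "indep_var N (X i) N (X j)"
proof -
  have "indep_var N ((\<lambda>h. h i) \<circ> (\<lambda>x. restrict (\<lambda>i. X i x) {i}))
      N ((\<lambda>h. h j) \<circ> (\<lambda>x. restrict (\<lambda>i. X i x) {j}))"
    using assms by (intro indep_var_compose[OF indep_var_restrict[OF ind]]) auto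
  then show ?thesis by (simp add: comp_def)
qed

text \<open>\<open>S\<close> and \<open>T\<close> are the signal parts at the later and the earlier
  time, \<open>W'\<close> and \<open>W\<close> the respective noises, and \<open>\<kappa>\<close> is
  the offset left by a frozen input. The factor \<open>e\<close> is 1 for the noisy output and 0 for
  its noise-free part.\<close>

lemma gaussian_channel:
  fixes S T W' W :: "'a \<Rightarrow> real" and \<kappa> e :: real
  assumes ST: "gaussian_rv M (\<lambda>x. (S x, T x))" and W': "gaussian_rv M W'" and W: "gaussian_rv M W"
    and noise: "indep_var borel W' borel W"
    and ind: "indep_var borel (\<lambda>x. (S x, T x)) borel (\<lambda>x. (W' x, W x))"
  defines "X \<equiv> \<lambda>x. S x + \<kappa> + W' x" and "Y \<equiv> \<lambda>x. T x + e * W x"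
  shows "gaussian_rv M (\<lambda>x. (X x, Y x))"
    and "covariance M X X = covariance M S S + covariance M W' W'"
    and "covariance M X Y = covariance M S T"
    and "covariance M Y Y = covariance M T T + e\<^sup>2 * covariance M W W"
proof -
  \<comment> \<open>Each noise is placed on its own axis of the plane, so that the noise pair is a
    sum of independent Gaussian vectors.\<close>
  have lin: "linear (\<lambda>r. (r, 0) :: real \<times> real)" "linear (\<lambda>r. (0, e * r) :: real \<times> real)"
    by (auto intro!: linearI simp: algebra_simps)
  have b: "f \<in> borel_measurable borel" if "linear f" for f :: "real \<Rightarrow> real \<times> real"
    using that by (intro borel_measurable_continuous_onI linear_continuous_on)
      (simp add: linear_conv_bounded_linear)
  have "indep_var borel ((\<lambda>r. (r, 0)) \<circ> W') borel ((\<lambda>r. (0, e * r)) \<circ> W)"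
    by (rule indep_var_compose[OF noise b[OF lin(1)] b[OF lin(2)]])
  then have N: "gaussian_rv M (\<lambda>x. (W' x, e * W x))"
    using gaussian_rv_add_indep[OF gaussian_rv_linear[OF W' lin(1)] gaussian_rv_linear[OF W lin(2)]]
    by (simp add: comp_def)
  have [measurable]: "(\<lambda>p. (fst p, e * snd p) :: real \<times> real) \<in> borel_measurable borel"
    by (simp add: borel_prod[symmetric])
  have "indep_var borel ((\<lambda>p. p) \<circ> (\<lambda>x. (S x, T x))) borel ((\<lambda>p. (fst p, e * snd p)) \<circ> (\<lambda>x. (W' x, W x)))"
    by (rule indep_var_compose[OF ind]) measurable
  then have "gaussian_rv M (\<lambda>x. (S x, T x) + (W' x, e * W x))"
    by (intro gaussian_rv_add_indep ST N) (simp add: comp_def)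
  from gaussian_rv_translate[OF this, of "(\<kappa>, 0)"]
  show "gaussian_rv M (\<lambda>x. (X x, Y x))"
    by (simp add: X_def Y_def add.commute add.left_commute)
  note comb = gaussian_rv_pair_combination[OF ST]
  from comb[of 1 0] comb[of 0 1] have S: "gaussian_rv M S" and T: "gaussian_rv M T" by simp_all
  note si = S[THEN gaussian_rv_square_integrable] T[THEN gaussian_rv_square_integrable]
    W[THEN gaussian_rv_square_integrable] W'[THEN gaussian_rv_square_integrable]
  have [measurable]: "(fst :: real \<times> real \<Rightarrow> real) \<in> borel_measurable borel"
    "(snd :: real \<times> real \<Rightarrow> real) \<in> borel_measurable borel"
    by (simp_all add: borel_prod[symmetric])
  \<comment> \<open>Coordinate projections turn independence of the two pairs into independence of
    each signal part from each noise.\<close>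
  have comp: "indep_var borel (\<lambda>x. f (S x, T x)) borel (\<lambda>x. g (W' x, W x))"
    if "f \<in> borel_measurable borel" "g \<in> borel_measurable borel" for f g :: "real \<times> real \<Rightarrow> real"
    using indep_var_compose[OF ind that] by (simp add: comp_def)
  have cov0: "covariance M S W' = 0" "covariance M S W = 0" "covariance M T W' = 0" "covariance M T W = 0"
    "covariance M W' W = 0"
    using comp[of fst fst] comp[of fst snd] comp[of snd fst] comp[of snd snd] noise si
    by (simp_all add: covariance_indep)
  have cov0': "covariance M W' S = 0" "covariance M W S = 0" "covariance M W' T = 0" "covariance M W T = 0"
    "covariance M W W' = 0"
    using cov0 by (simp_all add: covariance_commute)
  note cs = covariance_add_left covariance_add_right covariance_cmult_left covariance_cmult_right
    covariance_const_left covariance_const_right square_integrable_add square_integrable_cmult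
    square_integrable_const si cov0 cov0'
  show "covariance M X X = covariance M S S + covariance M W' W'"
    "covariance M X Y = covariance M S T"
    "covariance M Y Y = covariance M T T + e\<^sup>2 * covariance M W W"
    unfolding X_def Y_def by (simp_all add: cs power2_eq_square)
qed

lemma covariance_eq_0_if_uncorrelated:
  fixes U :: "'a \<Rightarrow> real" and Z :: "'a \<Rightarrow> real ^ 'n"
  assumes U: "square_integrable M U" and Z: "\<And>i. square_integrable M (\<lambda>x. Z x $ i)"
    and mean: "expectation U = 0" and unc: "(\<integral>x. U x *\<^sub>R Z x \<partial>M) = 0"
  shows "covariance M U (\<lambda>x. Z x $ i) = 0"
proof -
  have eq: "U x *\<^sub>R Z x = (\<Sum>i\<in>UNIV. (U x * Z x $ i) *\<^sub>R axis i 1)" for x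
    by (subst basis_expansion[of "Z x", symmetric])
      (simp add: scaleR_sum_right scalar_mult_eq_scaleR)
  \<comment> \<open>The Bochner integral of a non-integrable function is 0 by default, so
    integrability comes first; only then may \<open>unc\<close> be read componentwise.\<close>
  have "integrable M (\<lambda>x. U x *\<^sub>R Z x)"
    unfolding eq using U Z by (intro Bochner_Integration.integrable_sum integrable_scaleR_left square_integrable_mult)
  then have "(\<integral>x. (U x *\<^sub>R Z x) $ i \<partial>M) = (\<integral>x. U x *\<^sub>R Z x \<partial>M) $ i"
    by (rule integral_bounded_linear[OF bounded_linear_vec_nth])
  then show ?thesis using unc mean U Z by (simp add: covariance_eq)
qed

end

section \<open>One-by-one matrices read as scalars\<close>

lemma matrix_inv_1x1:
  fixes V :: "real ^ 1 ^ 1"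
  assumes "invertible V"
  shows "V $ 1 $ 1 \<noteq> 0" and "matrix_inv V $ 1 $ 1 = 1 / V $ 1 $ 1"
proof -
  \<comment> \<open>\<open>matrix_inv\<close> is defined by choice; invertibility supplies its
    defining equation.\<close>
  have "(V ** matrix_inv V) $ 1 $ 1 = 1"
    using someI_ex[OF assms[unfolded invertible_def], folded matrix_inv_def] by (simp add: mat_def)
  then have eq: "V $ 1 $ 1 * matrix_inv V $ 1 $ 1 = 1"
    by (simp add: matrix_matrix_mult_def UNIV_1)
  then show "V $ 1 $ 1 \<noteq> 0" by auto
  then show "matrix_inv V $ 1 $ 1 = 1 / V $ 1 $ 1" using eq by (simp add: field_simps)
qed

lemma mat_1x1_eq_iff: "mat k = (S :: real ^ 1 ^ 1) \<longleftrightarrow> k = S $ 1 $ 1"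
  by (auto simp: vec_eq_iff mat_def forall_1)

lemma log_normal_entropy_diff:
  fixes b d d' :: real
  assumes "1 < b" "0 < d" "0 < d'"
  shows "log b (2 * pi * exp 1 * d) / 2 - log b (2 * pi * exp 1 * d') / 2 = 1 / 2 * log b (d / d')"
  using assms by (simp add: log_mult log_divide field_simps)

lemma sandwich_transpose_mult:
  fixes K :: "real ^ 'n ^ 'm"
  shows "K ** L ** S ** transpose L ** transpose K = (K ** L) ** S ** transpose (K ** L)"
  by (simp add: matrix_transpose_mul matrix_mul_assoc)

text \<open>Grouping the factors as \<open>C ** A\<close> and \<open>C ** B\<close> gives the form
  produced by \<open>covariance_matrix_vector\<close> and turns the input contribution into a square
  times the input variance.\<close>

lemma Sigma_cond_1x1:
  fixes A :: "real ^ 'n ^ 'n" and B :: "real ^ 1 ^ 'n" and C :: "real ^ 'n ^ 1"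
  assumes "invertible V"
  shows "Sigma_cond A B C Sz Su Sw V $ 1 $ 1 = ((C ** A) ** Sz ** transpose (C ** A)) $ 1 $ 1
      + ((C ** B) $ 1 $ 1)\<^sup>2 * Su $ 1 $ 1 + Sw $ 1 $ 1
      - (((C ** A) ** Sz ** transpose C) $ 1 $ 1)\<^sup>2 / V $ 1 $ 1"
    and "Sigma_cond_frozen A C Sz Sw V $ 1 $ 1 = ((C ** A) ** Sz ** transpose (C ** A)) $ 1 $ 1
      + Sw $ 1 $ 1 - (((C ** A) ** Sz ** transpose C) $ 1 $ 1)\<^sup>2 / V $ 1 $ 1"
proof -
  have sandwich: "(K ** L ** transpose K) $ 1 $ 1 = (K $ 1 $ 1)\<^sup>2 * L $ 1 $ 1"
    for K L :: "real ^ 1 ^ 1"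
    by (simp add: matrix_matrix_mult_def transpose_def UNIV_1 power2_eq_square)
  show "Sigma_cond A B C Sz Su Sw V $ 1 $ 1 = ((C ** A) ** Sz ** transpose (C ** A)) $ 1 $ 1
      + ((C ** B) $ 1 $ 1)\<^sup>2 * Su $ 1 $ 1 + Sw $ 1 $ 1
      - (((C ** A) ** Sz ** transpose C) $ 1 $ 1)\<^sup>2 / V $ 1 $ 1"
    and "Sigma_cond_frozen A C Sz Sw V $ 1 $ 1 = ((C ** A) ** Sz ** transpose (C ** A)) $ 1 $ 1
      + Sw $ 1 $ 1 - (((C ** A) ** Sz ** transpose C) $ 1 $ 1)\<^sup>2 / V $ 1 $ 1"
    unfolding Sigma_cond_def Sigma_cond_frozen_def sandwich_transpose_mult
    by (simp_all only: vector_add_component vector_minus_component sandwich matrix_inv_1x1(2)[OF assms]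
        times_divide_eq_right mult_1_right)
qed

text \<open>The variance of \<open>\<theta> t\<close> is \<open>V\<close>, noise included, so
  conditioning on the output inverts \<open>V\<close>. The inverse of
  \<open>C ** \<Sigma>z ** transpose C\<close> alone belongs to conditioning on
  \<open>C z(t)\<close>, which the final implication treats.\<close>

theorem mainTheorem5:
  fixes M :: "'a measure" and b :: real
    and A :: "real ^ 'n ^ 'n" and B :: "real ^ 1 ^ 'n" and C :: "real ^ 'n ^ 1"
    and z :: "nat \<Rightarrow> 'a \<Rightarrow> real ^ 'n"
    and u \<omega> \<theta> :: "nat \<Rightarrow> 'a \<Rightarrow> real"
    and c :: real and t :: nat
    and \<Sigma>z :: "real ^ 'n ^ 'n" and \<Sigma>u \<Sigma>\<omega> V V0 :: "real ^ 1 ^ 1"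
  assumes "prob_space M" and "1 < b"
    and state_eq: "\<And>s x. x \<in> space M \<Longrightarrow> z (Suc s) x = A *v z s x + B *v vec (u s x)"
    and output_eq: "\<And>s x. x \<in> space M \<Longrightarrow> \<theta> s x = (C *v z s x) $ 1 + \<omega> s x"
    and noise_gaussian: "\<And>s. gaussian_rv M (\<omega> s)"
    and noise_mean: "\<And>s. (\<integral>x. \<omega> s x \<partial>M) = 0"
    and noise_indep: "prob_space.indep_vars M (\<lambda>_. borel) \<omega> UNIV"
    and noise_ident: "\<And>s s'. distr M borel (\<omega> s) = distr M borel (\<omega> s')"
    and noise_indep_system:
      "indep_rv M
         (Pi\<^sub>M UNIV (\<lambda>_. borel)) (\<lambda>x s. (z s x, u s x))
         (Pi\<^sub>M UNIV (\<lambda>_. borel)) (\<lambda>x s. \<omega> s x)"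
    and input_indep: "prob_space.indep_vars M (\<lambda>_. borel) u UNIV"
    and input_ident: "\<And>s s'. distr M borel (u s) = distr M borel (u s')"
    and input_uncorrelated: "\<And>s s'. s \<noteq> s' \<Longrightarrow> (\<integral>x. u s x * u s' x \<partial>M) = 0"
    and state_input_gaussian: "\<And>s. gaussian_rv M (\<lambda>x. (z s x, u s x))"
    and state_input_uncorrelated: "\<And>s. (\<integral>x. u s x *\<^sub>R z s x \<partial>M) = 0"
    and cov_z: "\<Sigma>z = cov_matrix M (z t)"
    and cov_u: "\<Sigma>u = cov_matrix M (\<lambda>x. vec (u t x))"
    and cov_w: "\<Sigma>\<omega> = cov_matrix M (\<lambda>x. vec (\<omega> t x))"
    and V: "V = C ** \<Sigma>z ** transpose C + \<Sigma>\<omega>"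
    and V0: "V0 = C ** \<Sigma>z ** transpose C"
    and V_inv: "invertible V"
    and nondegenerate: "0 < det (Sigma_cond_frozen A C \<Sigma>z \<Sigma>\<omega> V)"
  shows
    "information_transfer b M A B C z \<omega> \<theta> c t =
       1 / 2 * log b (det (Sigma_cond A B C \<Sigma>z \<Sigma>u \<Sigma>\<omega> V) / det (Sigma_cond_frozen A C \<Sigma>z \<Sigma>\<omega> V))
     \<and> (AE x in M. mat (cond_cov M (\<theta> (Suc t)) (\<theta> t) x) = Sigma_cond A B C \<Sigma>z \<Sigma>u \<Sigma>\<omega> V)
     \<and> (AE x in M. mat (cond_cov M (frozen_output A B C z \<omega> c t) (\<theta> t) x)
                     = Sigma_cond_frozen A C \<Sigma>z \<Sigma>\<omega> V)
     \<and> (invertible V0 \<and> 0 < det (Sigma_cond_frozen A C \<Sigma>z \<Sigma>\<omega> V0) \<longrightarrow>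
         diff_cond_entropy b M (\<theta> (Suc t)) (\<lambda>x. (C *v z t x) $ 1)
           - diff_cond_entropy b M (frozen_output A B C z \<omega> c t) (\<lambda>x. (C *v z t x) $ 1)
         = 1 / 2 * log b (det (Sigma_cond A B C \<Sigma>z \<Sigma>u \<Sigma>\<omega> V0)
                          / det (Sigma_cond_frozen A C \<Sigma>z \<Sigma>\<omega> V0))
         \<and> (AE x in M. mat (cond_cov M (\<theta> (Suc t)) (\<lambda>x. (C *v z t x) $ 1) x)
                         = Sigma_cond A B C \<Sigma>z \<Sigma>u \<Sigma>\<omega> V0)
         \<and> (AE x in M. mat (cond_cov M (frozen_output A B C z \<omega> c t) (\<lambda>x. (C *v z t x) $ 1) x)
                         = Sigma_cond_frozen A C \<Sigma>z \<Sigma>\<omega> V0))"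
proof -
  interpret prob_space M by fact
  note b = \<open>1 < b\<close>
  have zu: "gaussian_rv M (\<lambda>x. f (z t x, u t x))" if "linear f"
    for f :: "(real ^ 'n) \<times> real \<Rightarrow> 'v::euclidean_space"
    using that by (rule gaussian_rv_linear[OF state_input_gaussian])
  have u_gauss: "gaussian_rv M (u s)" for s
    using gaussian_rv_linear[OF state_input_gaussian linear_snd, of s] by simp
  then have [measurable]: "u s \<in> borel_measurable M" for s by (simp add: gaussian_rv_def)
  have siu: "square_integrable M (u s)" for s by (rule gaussian_rv_square_integrable[OF u_gauss])
  have siz: "square_integrable M (\<lambda>x. z t x $ i)" for i
  proof -
    have "linear (\<lambda>p. fst p $ i :: real)" by (intro linearI) auto
    from gaussian_rv_square_integrable[OF zu[OF this]] show ?thesis by simp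
  qed
  \<comment> \<open>Independence and vanishing correlation of \<open>u 0\<close> and
    \<open>u 1\<close> make the product of their means zero; identical laws make the two means
    equal, so the common mean is 0.\<close>
  have mean_u: "expectation (u s) = 0" for s
  proof -
    have "indep_var borel (u 0) borel (u 1)"
      by (rule indep_vars_imp_indep_var[OF input_indep]) auto
    then have "expectation (u 0) * expectation (u 1) = 0"
      using input_uncorrelated[of 0 1] siu
      by (simp add: indep_var_lebesgue_integral square_integrable_integrable)
    moreover have "expectation (u s') = (\<integral>r. r \<partial>distr M borel (u s'))" for s'
      by (simp add: integral_distr)
    ultimately show ?thesis using input_ident[of s 0] input_ident[of s 1] by auto
  qed
  \<comment> \<open>Because the input has mean zero, the vanishing moment \<open>E[u z]\<close> is a
    vanishing covariance.\<close>
  have cov_uz: "covariance M (u t) (\<lambda>x. (K *v z t x) $ i) = 0" for K :: "real ^ 'n ^ 'k" and i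
  proof -
    have "covariance M (u t) (\<lambda>x. z t x $ j) = 0" for j
      by (rule covariance_eq_0_if_uncorrelated[OF siu siz mean_u state_input_uncorrelated])
    then show ?thesis
      by (simp add: matrix_vector_mult_def covariance_sum_right covariance_cmult_right
          square_integrable_cmult siz siu)
  qed
  have noise_indep2: "indep_var borel (\<omega> (Suc t)) borel (\<omega> t)"
    by (rule indep_vars_imp_indep_var[OF noise_indep]) auto
  have [measurable]: "\<omega> s \<in> borel_measurable M" for s
    using noise_gaussian by (simp add: gaussian_rv_def)
  have cov_noise: "covariance M (\<omega> s) (\<omega> s) = \<Sigma>\<omega> $ 1 $ 1" for s
  proof -
    have "covariance M (\<omega> s) (\<omega> s) = covariance M (\<omega> t) (\<omega> t)"
      by (rule covariance_self_eq_distr) (use noise_ident[of s t] in auto)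
    then show ?thesis by (simp add: cov_w cov_matrix_def covariance_def vec_def)
  qed
  have cov_input: "covariance M (u t) (u t) = \<Sigma>u $ 1 $ 1"
    by (simp add: cov_u cov_matrix_def covariance_def vec_def)
  have cov_lin: "covariance M (\<lambda>x. (K *v z t x) $ i) (\<lambda>x. (L *v z t x) $ j)
      = (K ** \<Sigma>z ** transpose L) $ i $ j" for K :: "real ^ 'n ^ 1" and L :: "real ^ 'n ^ 1" and i j
    unfolding cov_z by (rule covariance_matrix_vector[OF siz])
  have si_lin: "square_integrable M (\<lambda>x. (K *v z t x) $ i)" for K :: "real ^ 'n ^ 1" and i
    by (rule square_integrable_matrix_vector[OF siz])
  define \<beta> where "\<beta> = (C ** B) $ 1 $ 1"
  define a where "a = ((C ** A) ** \<Sigma>z ** transpose (C ** A)) $ 1 $ 1"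
  define m where "m = ((C ** A) ** \<Sigma>z ** transpose C) $ 1 $ 1"
  define v where "v = (C ** \<Sigma>z ** transpose C) $ 1 $ 1"
  have input_term: "(C *v (B *v vec r)) $ 1 = \<beta> * r" for r
    by (simp add: \<beta>_def matrix_vector_mult_def matrix_matrix_mult_def UNIV_1 sum_distrib_right mult.assoc)

  have pair: "gaussian_rv M (\<lambda>x. (X x, Y x))"
      "covariance M X X = a + d\<^sup>2 * (\<beta>\<^sup>2 * \<Sigma>u $ 1 $ 1) + \<Sigma>\<omega> $ 1 $ 1"
      "covariance M X Y = m"
      "covariance M Y Y = v + e\<^sup>2 * \<Sigma>\<omega> $ 1 $ 1"
    if X: "\<forall>x\<in>space M. X x = (C *v (A *v z t x)) $ 1 + d * (\<beta> * u t x) + \<kappa> + \<omega> (Suc t) x"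
      and Y: "\<forall>x\<in>space M. Y x = (C *v z t x) $ 1 + e * \<omega> t x"
    for X Y and d \<kappa> e :: real
  proof -
    let ?S = "\<lambda>x. ((C ** A) *v z t x) $ 1 + d * (\<beta> * u t x)" and ?T = "\<lambda>x. (C *v z t x) $ 1"
    define f where "f = (\<lambda>p. (((C ** A) *v fst p) $ 1 + d * (\<beta> * snd p), (C *v fst p) $ 1) :: real \<times> real)"
    have f: "linear f"
      unfolding f_def
      by (intro linearI) (auto simp: matrix_vector_right_distrib matrix_vector_mult_scaleR algebra_simps)
    have f_borel: "f \<in> borel_measurable borel"
      using f by (intro borel_measurable_continuous_onI linear_continuous_on) (simp add: linear_conv_bounded_linear)
    have ST: "gaussian_rv M (\<lambda>x. (?S x, ?T x))"
      using zu[OF f] by (simp add: f_def)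
    \<comment> \<open>The independence of the processes is used at coordinate \<open>t\<close> of
      state and input and at coordinates \<open>Suc t\<close> and \<open>t\<close> of the
      noise.\<close>
    have "(\<lambda>h. f (h t)) \<in> borel_measurable (Pi\<^sub>M UNIV (\<lambda>_. borel))"
      by (rule measurable_compose[OF _ f_borel]) (simp add: measurable_component_singleton)
    moreover have "(\<lambda>h. (h (Suc t), h t) :: real \<times> real) \<in> borel_measurable (Pi\<^sub>M UNIV (\<lambda>_::nat. borel))"
      by (intro borel_measurable_Pair measurable_component_singleton) simp_all
    ultimately have "indep_var borel (\<lambda>x. f ((\<lambda>s. (z s x, u s x)) t))
        borel (\<lambda>x. ((\<lambda>s. \<omega> s x) (Suc t), (\<lambda>s. \<omega> s x) t))"
      by (intro indep_rv_imp_indep_var[OF noise_indep_system]) (auto simp: space_PiM)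
    then have ind: "indep_var borel (\<lambda>x. (?S x, ?T x)) borel (\<lambda>x. (\<omega> (Suc t) x, \<omega> t x))"
      by (simp add: f_def)
    note ch = gaussian_channel[OF ST noise_gaussian noise_gaussian noise_indep2 ind]
    have X': "X x = ?S x + \<kappa> + \<omega> (Suc t) x" if "x \<in> space M" for x
      using X that by (simp add: matrix_vector_mul_assoc)
    have "gaussian_rv M (\<lambda>x. (X x, Y x))
        = gaussian_rv M (\<lambda>x. (?S x + \<kappa> + \<omega> (Suc t) x, ?T x + e * \<omega> t x))"
      by (rule gaussian_rv_cong) (simp add: X' Y)
    with ch(1) show "gaussian_rv M (\<lambda>x. (X x, Y x))" by simp
    have cov_zu: "covariance M (\<lambda>x. ((C ** A) *v z t x) $ 1) (u t) = 0"
      using cov_uz[of "C ** A" 1] by (simp only: covariance_commute)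
    have SS: "covariance M ?S ?S = a + d\<^sup>2 * (\<beta>\<^sup>2 * \<Sigma>u $ 1 $ 1)"
      by (simp add: covariance_add_left covariance_add_right covariance_cmult_left covariance_cmult_right
          square_integrable_add square_integrable_cmult siu si_lin cov_lin cov_input cov_uz cov_zu
          a_def power2_eq_square)
    have ST: "covariance M ?S ?T = m"
      by (simp add: covariance_add_left covariance_cmult_left
          square_integrable_cmult siu si_lin cov_lin cov_uz m_def)
    have cov_XX: "covariance M X X
        = covariance M (\<lambda>x. ?S x + \<kappa> + \<omega> (Suc t) x)
            (\<lambda>x. ?S x + \<kappa> + \<omega> (Suc t) x)"
      by (rule covariance_cong) (simp_all add: X' Y)
    have cov_XY: "covariance M X Y
        = covariance M (\<lambda>x. ?S x + \<kappa> + \<omega> (Suc t) x)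
            (\<lambda>x. ?T x + e * \<omega> t x)"
      by (rule covariance_cong) (simp_all add: X' Y)
    have cov_YY: "covariance M Y Y
        = covariance M (\<lambda>x. ?T x + e * \<omega> t x)
            (\<lambda>x. ?T x + e * \<omega> t x)"
      by (rule covariance_cong) (simp_all add: X' Y)
    show "covariance M X X = a + d\<^sup>2 * (\<beta>\<^sup>2 * \<Sigma>u $ 1 $ 1) + \<Sigma>\<omega> $ 1 $ 1"
      unfolding cov_XX ch(2) SS cov_noise ..
    show "covariance M X Y = m"
      unfolding cov_XY ch(3) ST ..
    show "covariance M Y Y = v + e\<^sup>2 * \<Sigma>\<omega> $ 1 $ 1"
      unfolding cov_YY ch(4) cov_noise cov_lin v_def ..
  qed

  have full: "\<forall>x\<in>space M. \<theta> (Suc t) x = (C *v (A *v z t x)) $ 1 + 1 * (\<beta> * u t x) + 0 + \<omega> (Suc t) x"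
    by (simp add: output_eq state_eq matrix_vector_right_distrib input_term)
  have frozen: "\<forall>x\<in>space M. frozen_output A B C z \<omega> c t x
      = (C *v (A *v z t x)) $ 1 + 0 * (\<beta> * u t x) + \<beta> * c + \<omega> (Suc t) x"
    by (simp add: frozen_output_def matrix_vector_right_distrib input_term)
  have \<Sigma>u_nonneg: "0 \<le> \<beta>\<^sup>2 * \<Sigma>u $ 1 $ 1"
    using covariance_self_nonneg[of "u t"] by (simp add: cov_input)

  \<comment> \<open>\<open>W\<close> stands for the variance of the conditioning variable
    \<open>Y\<close>, so that \<open>V\<close> and \<open>V0\<close> are both instances.\<close>
  have conclusion: "diff_cond_entropy b M (\<theta> (Suc t)) Y - diff_cond_entropy b M (frozen_output A B C z \<omega> c t) Y
        = 1 / 2 * log b (det (Sigma_cond A B C \<Sigma>z \<Sigma>u \<Sigma>\<omega> W) / det (Sigma_cond_frozen A C \<Sigma>z \<Sigma>\<omega> W))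
      \<and> (AE x in M. mat (cond_cov M (\<theta> (Suc t)) Y x) = Sigma_cond A B C \<Sigma>z \<Sigma>u \<Sigma>\<omega> W)
      \<and> (AE x in M. mat (cond_cov M (frozen_output A B C z \<omega> c t) Y x) = Sigma_cond_frozen A C \<Sigma>z \<Sigma>\<omega> W)"
    if Y: "\<forall>x\<in>space M. Y x = (C *v z t x) $ 1 + e * \<omega> t x"
      and W: "W $ 1 $ 1 = v + e\<^sup>2 * \<Sigma>\<omega> $ 1 $ 1"
      and inv: "invertible W" and pos: "0 < det (Sigma_cond_frozen A C \<Sigma>z \<Sigma>\<omega> W)"
    for Y W and e :: real
  proof -
    note F = pair[of "\<theta> (Suc t)" 1 0 Y e, OF full Y]
    note G = pair[of "frozen_output A B C z \<omega> c t" 0 "\<beta> * c" Y e, OF frozen Y]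
    define D where "D = Sigma_cond A B C \<Sigma>z \<Sigma>u \<Sigma>\<omega> W $ 1 $ 1"
    define D' where "D' = Sigma_cond_frozen A C \<Sigma>z \<Sigma>\<omega> W $ 1 $ 1"
    have vY: "covariance M Y Y = W $ 1 $ 1" using F(4) W by simp
    then have vY0: "covariance M Y Y \<noteq> 0" using matrix_inv_1x1(1)[OF inv] by simp
    have D: "D = covariance M (\<theta> (Suc t)) (\<theta> (Suc t)) - (covariance M (\<theta> (Suc t)) Y)\<^sup>2 / covariance M Y Y"
      unfolding D_def vY F(2) F(3) Sigma_cond_1x1(1)[OF inv] a_def m_def \<beta>_def by simp
    have D': "D' = covariance M (frozen_output A B C z \<omega> c t) (frozen_output A B C z \<omega> c t)
        - (covariance M (frozen_output A B C z \<omega> c t) Y)\<^sup>2 / covariance M Y Y"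
      unfolding D'_def vY G(2) G(3) Sigma_cond_1x1(2)[OF inv] a_def m_def \<beta>_def by simp
    have "0 < D'" using pos by (simp add: det_1 D'_def)
    moreover have "D = D' + \<beta>\<^sup>2 * \<Sigma>u $ 1 $ 1"
      unfolding D_def D'_def Sigma_cond_1x1[OF inv] \<beta>_def by simp
    ultimately have pos': "0 < D'" "0 < D" using \<Sigma>u_nonneg by simp_all
    note cF = gaussian_pair_conditional[OF b F(1) vY0 D]
    note cG = gaussian_pair_conditional[OF b G(1) vY0 D']
    show ?thesis
      using cF cG pos' log_normal_entropy_diff[OF b pos'(2,1)]
      by (simp add: det_1 mat_1x1_eq_iff D_def[symmetric] D'_def[symmetric])
  qed
  have "V $ 1 $ 1 = v + 1\<^sup>2 * \<Sigma>\<omega> $ 1 $ 1" "V0 $ 1 $ 1 = v + 0\<^sup>2 * \<Sigma>\<omega> $ 1 $ 1"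
    by (simp_all add: V V0 v_def)
  then show ?thesis
    unfolding information_transfer_def
    using conclusion[of "\<theta> t" 1 V] conclusion[of "\<lambda>x. (C *v z t x) $ 1" 0 V0] V_inv nondegenerate output_eq
    by simp
qed

end
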